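(* Let $\alpha,\beta\in(0,1)$. For every $m\in\{1,2,\dots\}$ and any ordering of the vertices $(y_\ell)_{\ell=1}^m$, the marginal distribution $\mathbf{K}^m$ obtained by recursive application of the junction-tree expander, defined by $\mathbf{K}^1\big((\{\{y_1\}\},\emptyset)\big)=1$ and $$\mathbf{K}^{m}(T_m)=\sum_{T\in\mathsf{T}_{m-1}}\mathbf{K}^{m-1}(T)\,\mathbf{K}_{m-1}(T,T_m),\qquad T_m\in\mathsf{T}_m,\ m\ge 2,$$ satisfies $$\operatorname{Supp}(\mathbf{K}^m)=\mathsf{T}_m .$$
   Context: Graphs are finite, undirected, without loops. A clique is a complete vertex set that is maximal with respect to inclusion. $G[W]$ is the subgraph of $G$ induced by the vertex set $W$. A graph $G$ is decomposable if its cliques can be arranged in a junction tree, i.e. a tree whose nodes are the cliques of $G$ and such that for any two cliques $c,c'$ the intersection $c\cap c'$ is contained in every node on the unique path between $c$ and $c'$ (junction tree property). Edges of a junction tree are called links; the link $(a,b)$ has associated separator $s_{a,b}=a\cap b$ (which may be empty). The vertices $y_1,y_2,\dots$ are distinct. $\mathsf{T}_m$ is the set of all junction trees of all decomposable graphs with vertex set $\{y_1,\dots,y_m\}$. $N_T(c)$ is the set of neighbors of node $c$ in $T$. $\operatorname{Supp}(h)=\{x:h(x)>0\}$. Subtree kernel. For a tree $T=(V,E)$ a random (possibly empty) subtree $T'=(V',E')$ is drawn with probability $\mathbf{S}^{\alpha,\beta}(T,T')=1-\beta$ if $T'=(\emptyset,\emptyset)$ and $\beta|V'|\alpha^{|V'|-1}(1-\alpha)^{w}/|V|$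 otherwise, where $w$ is the number of connected components of $T[V\setminus V']$. (A subtree is a connected subgraph.) Junction-tree expander. Given $T=(V,E)\in\mathsf{T}_m$, draw $T'=(V',E')\sim\mathbf{S}^{\alpha,\beta}(T,\cdot)$. If $T'$ is empty: add the new node $\{y_{m+1}\}$ to $T$, joined by a link to an arbitrary node of $T$; delete all links with empty separator; and reconnect the resulting forest into a tree by adding links, chosen uniformly at random among all possible ways to do so. Output this tree. If $T'$ is nonempty: enumerate $V'=\{c_1,\dots,c_{|V'|}\}$. For each $j$ put $z_j=\bigcup_{c\in N_{T'}(c_j)}s_{c_j,c}$. Independently over $j$, draw $q_j$ uniformly from the nonempty subsets of $c_j\setminus z_j$ if $z_j=s_{c_j,c}$ for some $c\in N_{T'}(c_j)$, and uniformly from all subsets of $c_j\setminus z_j$ otherwise. Put $d_j=z_j\cup q_j$ and add the new node $d_j^+=d_j\cup\{y_{m+1}\}$. For each link $(c_j,c_k)$ of $T'$, remove this link and add the link $(d_j^+,d_k^+)$. For each $j$ with $d_j=c_j$, delete the node $c_j$ and let all of $N_T(c_j)\setminus V'$ become neighbors of $d_j^+$. For each $j$ with $d_j\neq c_j$, add the link $(c_j,d_j^+)$, draw $n_j$ uniformly from the subsets of $\{c\in N_T(c_j)\setminus V': s_{c,c_j}\subseteq d_j\}$, and move the nodes in $n_j$ from being neighbors of $c_j$ to being neighbors of $d_j^+$. Output the resulting tree. $\mathbf{K}_m(T,T_+)=\mathbf{K}_m^{\alpha,\beta}(T,T_+)$ denotes the probability that this procedure outputs $T_+$ when the input is $T$;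 it is a Markov transition kernel from $\mathsf{T}_m$ to $\mathsf{T}_{m+1}$. *)

theory Defs
  imports "HOL-Probability.Probability"
begin

section \<open>Finite simple graphs and trees\<close>

text \<open>
  A graph is a pair of a vertex set and a set of edges, an edge being a two-element set of
  vertices.
\<close>

type_synonym 'a ugraph = "'a set \<times> 'a set set"

abbreviation verts :: "'a ugraph \<Rightarrow> 'a set" where
  "verts G \<equiv> fst G"

abbreviation edges :: "'a ugraph \<Rightarrow> 'a set set" where
  "edges G \<equiv> snd G"

definition simple_graph :: "'a ugraph \<Rightarrow> bool" where
  "simple_graph G \<longleftrightarrow> finite (verts G) \<and> (\<forall>e\<in>edges G. e \<subseteq> verts G \<and> card e = 2)"

definition neighbors :: "'a ugraph \<Rightarrow> 'a \<Rightarrow> 'a set" where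
  "neighbors G u = {v. {u, v} \<in> edges G}"

definition graph_path :: "'a ugraph \<Rightarrow> 'a list \<Rightarrow> bool" where
  "graph_path G p \<longleftrightarrow> p \<noteq> [] \<and> set p \<subseteq> verts G \<and> distinct p
     \<and> successively (\<lambda>u v. {u, v} \<in> edges G) p"

definition graph_cycle :: "'a ugraph \<Rightarrow> 'a list \<Rightarrow> bool" where
  "graph_cycle G p \<longleftrightarrow> graph_path G p \<and> 3 \<le> length p \<and> {last p, hd p} \<in> edges G"

definition linked :: "'a ugraph \<Rightarrow> 'a \<Rightarrow> 'a \<Rightarrow> bool" where
  "linked G u v \<longleftrightarrow> (\<exists>p. graph_path G p \<and> hd p = u \<and> last p = v)"

text \<open>The empty graph counts neither as connected nor as a tree.\<close>

definition connected_graph :: "'a ugraph \<Rightarrow> bool" where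
  "connected_graph G \<longleftrightarrow> verts G \<noteq> {} \<and> (\<forall>u\<in>verts G. \<forall>v\<in>verts G. linked G u v)"

definition graph_components :: "'a ugraph \<Rightarrow> 'a set set" where
  "graph_components G = (\<lambda>u. {v. linked G u v}) ` verts G"

definition induced :: "'a ugraph \<Rightarrow> 'a set \<Rightarrow> 'a ugraph" where
  "induced G W = (W, {e \<in> edges G. e \<subseteq> W})"

definition is_tree :: "'a ugraph \<Rightarrow> bool" where
  "is_tree T \<longleftrightarrow> simple_graph T \<and> connected_graph T \<and> (\<forall>p. \<not> graph_cycle T p)"


section \<open>Decomposable graphs and junction trees\<close>

definition complete_in :: "'a ugraph \<Rightarrow> 'a set \<Rightarrow> bool" where
  "complete_in G W \<longleftrightarrow> W \<subseteq> verts G \<and> (\<forall>u\<in>W. \<forall>v\<in>W. u \<noteq> v \<longrightarrow> {u, v} \<in> edges G)"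

definition cliques :: "'a ugraph \<Rightarrow> 'a set set" where
  "cliques G = {W. complete_in G W \<and> (\<forall>W'. complete_in G W' \<and> W \<subseteq> W' \<longrightarrow> W' = W)}"

definition junction_tree_of :: "'a ugraph \<Rightarrow> 'a set ugraph \<Rightarrow> bool" where
  "junction_tree_of G T \<longleftrightarrow> is_tree T \<and> verts T = cliques G
     \<and> (\<forall>p. graph_path T p \<longrightarrow> (\<forall>c\<in>set p. hd p \<inter> last p \<subseteq> c))"

definition decomposable :: "'a ugraph \<Rightarrow> bool" where
  "decomposable G \<longleftrightarrow> simple_graph G \<and> (\<exists>T. junction_tree_of G T)"

definition junction_trees :: "'a set \<Rightarrow> 'a set ugraph set" where
  "junction_trees Y = {T. \<exists>G. decomposable G \<and> verts G = Y \<and> junction_tree_of G T}"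


section \<open>The subtree kernel\<close>

text \<open>The subtrees of \<open>T\<close>, including the empty one.\<close>

definition subtrees :: "'a ugraph \<Rightarrow> 'a ugraph set" where
  "subtrees T = insert ({}, {})
     {T'. simple_graph T' \<and> connected_graph T' \<and> verts T' \<subseteq> verts T \<and> edges T' \<subseteq> edges T}"

definition subtree_kernel :: "real \<Rightarrow> real \<Rightarrow> 'a ugraph \<Rightarrow> 'a ugraph \<Rightarrow> real" where
  "subtree_kernel \<alpha> \<beta> T T' =
     (if T' = ({}, {}) then 1 - \<beta>
      else let w = card (graph_components (induced T (verts T - verts T')))
        in \<beta> * real (card (verts T')) * \<alpha> ^ (card (verts T') - 1) * (1 - \<alpha>) ^ w
             / real (card (verts T)))"


section \<open>The junction-tree expander\<close>

text \<open>
  In what follows \<open>x\<close> is the new vertex and \<open>U\<close> an output tree. A link is a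
  set \<open>{a, b}\<close> of two nodes, so its separator \<open>a \<inter> b\<close> is \<open>\<Inter>{a, b}\<close>.
\<close>

definition expand_empty :: "'a \<Rightarrow> 'a set ugraph \<Rightarrow> 'a set ugraph pmf" where
  "expand_empty x T =
     (let V = insert {x} (verts T);
          E = insert {{x}, SOME c. c \<in> verts T} (edges T);
          F = {e \<in> E. \<Inter>e \<noteq> {}}
      in pmf_of_set {U. is_tree U \<and> verts U = V \<and> F \<subseteq> edges U})"

text \<open>
  The nodes of the subtree index themselves: what carries an index \<open>j\<close> in an enumeration
  \<open>c\<^sub>1, c\<^sub>2, \<dots>\<close> of the subtree is a function of the node \<open>c\<close> here.
\<close>

definition sep_union :: "'a set ugraph \<Rightarrow> 'a set \<Rightarrow> 'a set" where
  "sep_union T' c = (\<Union>c'\<in>neighbors T' c. c \<inter> c')"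

definition extra_choices :: "'a set ugraph \<Rightarrow> 'a set \<Rightarrow> 'a set set" where
  "extra_choices T' c =
     (if \<exists>c'\<in>neighbors T' c. sep_union T' c = c \<inter> c'
      then Pow (c - sep_union T' c) - {{}}
      else Pow (c - sep_union T' c))"

definition movable :: "'a set ugraph \<Rightarrow> 'a set ugraph \<Rightarrow> ('a set \<Rightarrow> 'a set) \<Rightarrow> 'a set \<Rightarrow> 'a set set" where
  "movable T T' d c = {c' \<in> neighbors T c - verts T'. c' \<inter> c \<subseteq> d c}"

text \<open>
  The output tree for given choices of \<open>d\<close> and \<open>n\<close>. All remaining neighbours of \<open>c\<close> are handed
  over when \<open>d c = c\<close>, so \<open>n\<close> is used only at nodes with \<open>d c \<noteq> c\<close>.
\<close>

definition assemble ::
  "'a \<Rightarrow> 'a set ugraph \<Rightarrow> 'a set ugraph \<Rightarrow> ('a set \<Rightarrow> 'a set) \<Rightarrow> ('a set \<Rightarrow> 'a set set) \<Rightarrow> 'a set ugraph"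
where
  "assemble x T T' d n =
     (let dx = (\<lambda>c. insert x (d c));
          moved = (\<lambda>c. if d c = c then neighbors T c - verts T' else n c)
      in ((verts T - {c \<in> verts T'. d c = c}) \<union> dx ` verts T',
          (edges T - edges T' - {{c, c'} | c c'. c \<in> verts T' \<and> c' \<in> moved c})
            \<union> {{dx c, dx c'} | c c'. {c, c'} \<in> edges T'}
            \<union> {{c, dx c} | c. c \<in> verts T' \<and> d c \<noteq> c}
            \<union> {{dx c, c'} | c c'. c \<in> verts T' \<and> c' \<in> moved c}))"

definition expand_nonempty ::
  "'a \<Rightarrow> 'a set ugraph \<Rightarrow> 'a set ugraph \<Rightarrow> 'a set ugraph pmf" where
  "expand_nonempty x T T' = do {
     q \<leftarrow> Pi_pmf (verts T') {} (\<lambda>c. pmf_of_set (extra_choices T' c));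
     let d = (\<lambda>c. sep_union T' c \<union> q c);
     n \<leftarrow> Pi_pmf {c \<in> verts T'. d c \<noteq> c} {} (\<lambda>c. pmf_of_set (Pow (movable T T' d c)));
     return_pmf (assemble x T T' d n)
   }"

definition expand :: "'a \<Rightarrow> 'a set ugraph \<Rightarrow> 'a set ugraph \<Rightarrow> 'a set ugraph pmf" where
  "expand x T T' = (if T' = ({}, {}) then expand_empty x T else expand_nonempty x T T')"

text \<open>The output probability, by conditioning on the subtree that is drawn.\<close>

definition expander_kernel ::
  "real \<Rightarrow> real \<Rightarrow> 'a \<Rightarrow> 'a set ugraph \<Rightarrow> 'a set ugraph \<Rightarrow> real" where
  "expander_kernel \<alpha> \<beta> x T U =
     (\<Sum>T'\<in>subtrees T. subtree_kernel \<alpha> \<beta> T T' * pmf (expand x T T') U)"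


section \<open>Marginal distributions\<close>

text \<open>
  The vertices are \<open>y 1, y 2, \<dots>\<close>; the value at index \<open>0\<close> is a dummy. The functions are defined
  on all pairs of nodes and links, not only on junction trees, so vanishing outside the set of
  junction trees is a property and not part of the definition.
\<close>

fun marginal :: "real \<Rightarrow> real \<Rightarrow> (nat \<Rightarrow> 'a) \<Rightarrow> nat \<Rightarrow> 'a set ugraph \<Rightarrow> real" where
  "marginal \<alpha> \<beta> y 0 U = 0"
| "marginal \<alpha> \<beta> y (Suc 0) U = (if U = ({{y 1}}, {}) then 1 else 0)"
| "marginal \<alpha> \<beta> y (Suc (Suc m)) U =
     (\<Sum>T\<in>junction_trees (y ` {1..Suc m}).
        marginal \<alpha> \<beta> y (Suc m) T * expander_kernel \<alpha> \<beta> (y (Suc (Suc m))) T U)"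

definition Supp :: "('b \<Rightarrow> real) \<Rightarrow> 'b set" where
  "Supp h = {x. h x > 0}"

end

theory Submission
  imports Defs
begin

text \<open>
  A finite tree of sets is a junction tree of some decomposable graph iff its nodes form an
  antichain and, for every set \<open>W\<close>, the nodes containing \<open>W\<close> are connected; that the cliques of the
  graph are then exactly the nodes is the Helly property of subtrees. Connectivity reduces
  acyclicity to counting edges, so both directions below work with edge counts and with images of
  connected sets.

  The expander preserves this property: its output contracts onto the input tree by identifying
  each \<open>c\<close> with \<open>d c \<union> {x}\<close>. Conversely, given a junction tree \<open>U\<close> over \<open>Y \<union> {x}\<close>, every node \<open>D\<close>
  containing \<open>x\<close> is replaced by \<open>D - {x}\<close> if that set lies in no other node, and otherwise contracted
  into a neighbour containing \<open>D - {x}\<close>. The images of the nodes containing \<open>x\<close> form a nonempty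
  subtree from which the expander rebuilds \<open>U\<close>; since both are trees on the same nodes, it is enough
  to find every link of \<open>U\<close> in the rebuilt tree.
\<close>

section \<open>Trees and connectivity\<close>

text \<open>For the trees under construction only upper bounds on the number of links are needed:
  images and unions are easy to bound from above, and a connected graph with fewer links than nodes
  is already a tree. Cycles never have to be followed through the surgery on links.

  The rule that sometimes forces \<open>q\<close> to be nonempty says, for \<open>z\<close>
  \<subseteq> \<open>d\<close> \<subseteq> \<open>c\<close>, exactly that \<open>d\<close> lies in
  no neighbour of \<open>c\<close> within the subtree. In this form it yields the antichain of new
  nodes on the way forward, and on the way back it follows from the antichain of the nodes of
  \<open>U\<close>.

  The obstacle on the way back is that the neighbour to contract into is a choice. Choices at
  different nodes do not interfere, because two nodes containing \<open>x\<close> never share a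
  neighbour without \<open>x\<close>.

  Probability enters only through supports: the parameters lie strictly between 0 and 1, so every
  subtree and every admissible choice has positive weight, and a finite sum of nonnegative terms is
  positive iff one term is.\<close>

definition walk_rel :: "'a set set \<Rightarrow> 'a set \<Rightarrow> ('a \<times> 'a) set" where
  "walk_rel E A = {(a, b). a \<in> A \<and> b \<in> A \<and> {a, b} \<in> E}"

text \<open>Walks instead of repetition-free paths, so that connectivity passes to images without
  repairing repetitions. The empty set counts as connected: for a given \<open>W\<close> there may
  be no node above it.\<close>

definition conn_on :: "'a set set \<Rightarrow> 'a set \<Rightarrow> bool" where
  "conn_on E A \<longleftrightarrow> (\<forall>a\<in>A. \<forall>b\<in>A. (a, b) \<in> (walk_rel E A)\<^sup>*)"

lemma walk_rel_sym: "sym (walk_rel E A)"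
  by (auto simp: walk_rel_def sym_def insert_commute)

lemma walk_rel_rtrancl_sym: "(a, b) \<in> (walk_rel E A)\<^sup>* \<Longrightarrow> (b, a) \<in> (walk_rel E A)\<^sup>*"
  by (rule symD[OF sym_rtrancl[OF walk_rel_sym]])

text \<open>Links are compared only inside \<open>A\<close>. A walk that stays away from one end of
  a link therefore survives the deletion of that link.\<close>

lemma walk_rel_rtrancl_mono:
  assumes "(a, b) \<in> (walk_rel E A)\<^sup>*" "A \<subseteq> B"
    and "\<And>u v. u \<in> A \<Longrightarrow> v \<in> A \<Longrightarrow> {u, v} \<in> E \<Longrightarrow> {u, v} \<in> F"
  shows "(a, b) \<in> (walk_rel F B)\<^sup>*"
proof -
  have "walk_rel E A \<subseteq> walk_rel F B"
    using assms(2,3) by (auto simp: walk_rel_def)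
  then show ?thesis
    using assms(1) rtrancl_mono by blast
qed

lemma walk_rel_stepI: "a \<in> A \<Longrightarrow> b \<in> A \<Longrightarrow> {a, b} \<in> E \<Longrightarrow> (a, b) \<in> (walk_rel E A)\<^sup>*"
  by (auto simp: walk_rel_def)

lemma walk_rel_rtrancl_map:
  assumes "(a, b) \<in> (walk_rel E A)\<^sup>*"
    and "\<And>u v. u \<in> A \<Longrightarrow> v \<in> A \<Longrightarrow> {u, v} \<in> E \<Longrightarrow> (f u, f v) \<in> (walk_rel F B)\<^sup>*"
  shows "(f a, f b) \<in> (walk_rel F B)\<^sup>*"
  using assms(1)
proof induction
  case (step v w)
  then have "(f v, f w) \<in> (walk_rel F B)\<^sup>*"
    using assms(2) by (auto simp: walk_rel_def)
  with step.IH show ?case by (rule rtrancl_trans)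
qed simp

lemma conn_onI_center:
  assumes "\<And>a. a \<in> A \<Longrightarrow> (a, r) \<in> (walk_rel E A)\<^sup>*"
  shows "conn_on E A"
  unfolding conn_on_def by (meson assms walk_rel_rtrancl_sym rtrancl_trans)

text \<open>A link may go to a walk of any length and a target need only reach the image. This
  covers contraction, where both ends get the same image, as well as links rerouted through new
  nodes.\<close>

lemma conn_on_image:
  assumes "conn_on E A"
    and "\<And>u v. u \<in> A \<Longrightarrow> v \<in> A \<Longrightarrow> {u, v} \<in> E \<Longrightarrow> (f u, f v) \<in> (walk_rel F B)\<^sup>*"
    and "\<And>b. b \<in> B \<Longrightarrow> \<exists>a\<in>A. (b, f a) \<in> (walk_rel F B)\<^sup>*"
  shows "conn_on F B"
  unfolding conn_on_def
proof (intro ballI)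
  fix b b' assume "b \<in> B" "b' \<in> B"
  then obtain a a' where a: "a \<in> A" "a' \<in> A" "(b, f a) \<in> (walk_rel F B)\<^sup>*"
      "(b', f a') \<in> (walk_rel F B)\<^sup>*"
    using assms(3) by metis
  have "(f a, f a') \<in> (walk_rel F B)\<^sup>*"
    by (rule walk_rel_rtrancl_map[OF _ assms(2)]) (use assms(1) a(1,2) in \<open>auto simp: conn_on_def\<close>)
  then show "(b, b') \<in> (walk_rel F B)\<^sup>*"
    using a(3) walk_rel_rtrancl_sym[OF a(4)] by (meson rtrancl_trans)
qed

section \<open>Paths as lists against walks as closures\<close>

lemma graph_path_walk:
  assumes "p \<noteq> []" "successively (\<lambda>u v. {u, v} \<in> E) p"
  shows "(hd p, last p) \<in> (walk_rel E (set p))\<^sup>*"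
  using assms
proof (induction p)
  case (Cons a p)
  show ?case
  proof (cases p)
    case (Cons b q)
    then have "(b, last p) \<in> (walk_rel E (set p))\<^sup>*"
      using Cons.IH Cons.prems by auto
    then have "(b, last p) \<in> (walk_rel E (set (a # p)))\<^sup>*"
      by (rule walk_rel_rtrancl_mono) auto
    moreover have "(a, b) \<in> walk_rel E (set (a # p))"
      using Cons Cons.prems by (auto simp: walk_rel_def)
    ultimately show ?thesis
      using Cons by (auto intro: converse_rtrancl_into_rtrancl)
  qed simp
qed simp

lemma walk_graph_path:
  assumes "(u, v) \<in> (walk_rel (edges G) A)\<^sup>*" "u \<in> A" "A \<subseteq> verts G"
  shows "\<exists>p. graph_path G p \<and> set p \<subseteq> A \<and> hd p = u \<and> last p = v"
  using assms(1)
proof induction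
  case base
  show ?case
    using assms by (intro exI[of _ "[u]"]) (auto simp: graph_path_def)
next
  case (step v w)
  then obtain p where p: "graph_path G p" "set p \<subseteq> A" "hd p = u" "last p = v"
    by blast
  have w: "w \<in> A" "{v, w} \<in> edges G"
    using step.hyps by (auto simp: walk_rel_def)
  show ?case
  proof (cases "w \<in> set p")
    \<comment> \<open>The path is cut at the earlier visit to \<open>w\<close>, which keeps it free
      of repetitions.\<close>
    case True
    then obtain ys zs where "p = (ys @ [w]) @ zs"
      by (auto dest: split_list)
    then show ?thesis
      using p by (intro exI[of _ "ys @ [w]"])
        (auto simp: graph_path_def successively_append_iff hd_append split: if_splits)
  next
    case False
    then show ?thesis
      using p w assms(3) by (intro exI[of _ "p @ [w]"])
        (auto simp: graph_path_def successively_append_iff)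
  qed
qed

lemma linked_iff:
  "linked G u v \<longleftrightarrow> u \<in> verts G \<and> (u, v) \<in> (walk_rel (edges G) (verts G))\<^sup>*"
proof
  assume "linked G u v"
  then obtain p where p: "graph_path G p" "hd p = u" "last p = v"
    by (auto simp: linked_def)
  then have "(u, v) \<in> (walk_rel (edges G) (set p))\<^sup>*"
    using graph_path_walk[of p] by (auto simp: graph_path_def)
  then have "(u, v) \<in> (walk_rel (edges G) (verts G))\<^sup>*"
    by (rule walk_rel_rtrancl_mono) (use p in \<open>auto simp: graph_path_def\<close>)
  then show "u \<in> verts G \<and> (u, v) \<in> (walk_rel (edges G) (verts G))\<^sup>*"
    using p by (auto simp: graph_path_def)
next
  assume "u \<in> verts G \<and> (u, v) \<in> (walk_rel (edges G) (verts G))\<^sup>*"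
  then show "linked G u v"
    using walk_graph_path[of u v G "verts G"] by (auto simp: linked_def)
qed

lemma connected_graph_iff:
  "connected_graph G \<longleftrightarrow> verts G \<noteq> {} \<and> conn_on (edges G) (verts G)"
  by (auto simp: connected_graph_def conn_on_def linked_iff)

lemma connected_graph_pathE:
  assumes "connected_graph G" "u \<in> verts G" "v \<in> verts G"
  obtains p where "graph_path G p" "hd p = u" "last p = v"
  using assms unfolding connected_graph_def linked_def by blast

lemma graph_path_mono:
  assumes "graph_path S p" "verts S \<subseteq> verts T" "edges S \<subseteq> edges T"
  shows "graph_path T p"
proof -
  have "successively (\<lambda>u v. {u, v} \<in> edges T) p"
    using assms(1,3) unfolding graph_path_def
    by (metis (no_types, lifting) successively_mono subsetD)
  then show ?thesis
    using assms(1,2) by (auto simp: graph_path_def)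
qed

lemma finite_edges: "simple_graph G \<Longrightarrow> finite (edges G)"
  by (rule finite_subset[of _ "Pow (verts G)"]) (auto simp: simple_graph_def)

section \<open>Edge counts, spanning trees and acyclicity\<close>

lemma exists_leaving_edge:
  assumes "conn_on E V" "u \<in> S" "w \<in> V - S" "S \<subseteq> V"
  shows "\<exists>a\<in>S. \<exists>b\<in>V - S. {a, b} \<in> E"
proof (rule ccontr)
  assume no: "\<not> ?thesis"
  have "(u, w) \<in> (walk_rel E V)\<^sup>*"
    using assms by (auto simp: conn_on_def)
  then have "w \<in> S"
    by induction (use assms no in \<open>auto simp: walk_rel_def\<close>)
  then show False using assms by auto
qed

text \<open>A connected part grows by one vertex and one edge at a time. The invariant
  \<open>F \<subseteq> Pow S\<close> makes every added edge new, which gives the exact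
  count.\<close>

lemma exists_spanning_tree:
  assumes "finite V" "V \<noteq> {}" "conn_on E V"
  obtains F where "F \<subseteq> E" "conn_on F V" "card F + 1 = card V"
proof -
  have "k < card V \<Longrightarrow> \<exists>S F. S \<subseteq> V \<and> card S = Suc k \<and> F \<subseteq> E \<and> F \<subseteq> Pow S \<and> card F = k
      \<and> conn_on F S" for k
  proof (induction k)
    case 0
    obtain v where "v \<in> V" using assms by auto
    then show ?case
      by (intro exI[of _ "{v}"] exI[of _ "{}"]) (auto simp: conn_on_def)
  next
    case (Suc k)
    then obtain S F where S: "S \<subseteq> V" "card S = Suc k" "F \<subseteq> E" "F \<subseteq> Pow S" "card F = k" "conn_on F S"
      by auto
    have fin: "finite S" using S(1) assms(1) finite_subset by auto
    have "S \<noteq> V" using Suc.prems S(2) by auto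
    then obtain w where "w \<in> V - S" using S(1) by auto
    moreover obtain u where "u \<in> S" using S(2) by fastforce
    ultimately obtain a b where ab: "a \<in> S" "b \<in> V - S" "{a, b} \<in> E"
      using exists_leaving_edge[OF assms(3) _ _ S(1)] by blast
    let ?S = "insert b S" and ?F = "insert {a, b} F"
    have "(s, a) \<in> (walk_rel ?F ?S)\<^sup>*" if "s \<in> ?S" for s
    proof (cases "s = b")
      case True
      then show ?thesis using ab by (intro walk_rel_stepI) (auto simp: insert_commute)
    next
      case False
      then have "(s, a) \<in> (walk_rel F S)\<^sup>*"
        using that S(6) ab by (auto simp: conn_on_def)
      then show ?thesis by (rule walk_rel_rtrancl_mono) auto
    qed
    then have "conn_on ?F ?S" by (rule conn_onI_center)
    moreover have "{a, b} \<notin> F" using S(4) ab by auto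
    moreover have "finite F" using S(4) fin by (meson finite_Pow_iff finite_subset)
    ultimately show ?case
      using S ab fin by (intro exI[of _ ?S] exI[of _ ?F]) auto
  qed
  moreover have "card V > 0" using assms by (simp add: card_gt_0_iff)
  ultimately obtain S F where "S \<subseteq> V" "card S = card V" "F \<subseteq> E" "card F = card V - 1" "conn_on F S"
    by (metis Suc_diff_1 diff_less zero_less_one)
  then show ?thesis
    using that assms(1) \<open>card V > 0\<close> by (metis Suc_diff_1 Suc_eq_plus1 card_subset_eq)
qed

lemma conn_on_card_le:
  assumes "finite V" "V \<noteq> {}" "conn_on E V" "finite E"
  shows "card V \<le> card E + 1"
  using exists_spanning_tree[OF assms(1-3)] assms(4) by (metis add_le_mono1 card_mono)

text \<open>With fewer edges than vertices there is no edge to spare: if \<open>u\<close> and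
  \<open>v\<close> stayed joined, the deleted edge could be rerouted and too few edges would connect
  \<open>V\<close>.\<close>

lemma edge_is_bridge:
  assumes "finite V" "finite E" "conn_on E V" "card E < card V" "{u, v} \<in> E" "u \<in> V" "v \<in> V"
  shows "(u, v) \<notin> (walk_rel (E - {{u, v}}) V)\<^sup>*"
proof
  let ?E = "E - {{u, v}}"
  assume uv: "(u, v) \<in> (walk_rel ?E V)\<^sup>*"
  have "conn_on ?E V"
  proof (rule conn_on_image[OF assms(3), where f = id])
    fix a b assume ab: "a \<in> V" "b \<in> V" "{a, b} \<in> E"
    show "(id a, id b) \<in> (walk_rel ?E V)\<^sup>*"
    proof (cases "{a, b} = {u, v}")
      case True
      then show ?thesis
        using uv walk_rel_rtrancl_sym[OF uv] by (auto simp: doubleton_eq_iff)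
    next
      case False
      with ab show ?thesis by (auto intro: walk_rel_stepI)
    qed
  qed auto
  then have "card V \<le> card ?E + 1"
    using assms by (intro conn_on_card_le) auto
  then show False
    using assms by (metis One_nat_def Suc_eq_plus1 card_Suc_Diff1 not_le)
qed

lemma is_treeI:
  assumes "simple_graph T" "verts T \<noteq> {}" "conn_on (edges T) (verts T)"
    and "card (edges T) < card (verts T)"
  shows "is_tree T"
proof -
  have False if cyc: "graph_cycle T p" for p
  proof -
    have p: "graph_path T p" "3 \<le> length p" and e: "{last p, hd p} \<in> edges T"
      using cyc by (auto simp: graph_cycle_def)
    \<comment> \<open>At least three nodes leave a nonempty middle \<open>q\<close>, so the path
      from \<open>a\<close> to \<open>b\<close> through \<open>q\<close> never uses the closing edge
      \<open>{a, b}\<close>, which thus fails to be a bridge.\<close>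
    obtain a q b where q: "p = a # q @ [b]" "q \<noteq> []"
    proof -
      obtain a r where "p = a # r" using p(2) by (cases p) auto
      moreover have "r \<noteq> []" using p(2) calculation by auto
      moreover have "butlast r \<noteq> []" using p(2) calculation by (cases r) auto
      ultimately show ?thesis using that by (metis append_butlast_last_id)
    qed
    let ?E = "edges T - {{a, b}}"
    have dist: "a \<notin> set q" "b \<notin> set q" "a \<noteq> b" and V: "set p \<subseteq> verts T"
      and succ: "successively (\<lambda>u v. {u, v} \<in> edges T) ((a # q) @ [b])"
      using p q by (auto simp: graph_path_def)
    have "(hd (a # q), last (a # q)) \<in> (walk_rel (edges T) (set (a # q)))\<^sup>*"
      using succ unfolding successively_append_iff by (intro graph_path_walk) auto
    then have "(a, last q) \<in> (walk_rel ?E (verts T))\<^sup>*"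
      using q by (auto elim!: walk_rel_rtrancl_mono)
        (use V dist q in \<open>auto simp: doubleton_eq_iff\<close>)
    moreover have "(last q, b) \<in> (walk_rel ?E (verts T))\<^sup>*"
    proof (rule walk_rel_stepI)
      have l: "last q \<in> set q" using q by auto
      then show "last q \<in> verts T" "b \<in> verts T" using V q by auto
      show "{last q, b} \<in> ?E"
        using succ q l dist by (subst (asm) successively_append_iff) (auto simp: doubleton_eq_iff)
    qed
    ultimately have "(a, b) \<in> (walk_rel ?E (verts T))\<^sup>*" by (rule rtrancl_trans)
    moreover have "(a, b) \<notin> (walk_rel ?E (verts T))\<^sup>*"
      using assms e q V by (intro edge_is_bridge finite_edges)
        (auto simp: simple_graph_def insert_commute)
    ultimately show False by simp
  qed
  then show ?thesis
    using assms by (auto simp: is_tree_def connected_graph_iff)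
qed

text \<open>An edge of \<open>T\<close> missing in \<open>S\<close> would close a cycle.\<close>

lemma tree_subgraph_edge:
  assumes "is_tree T" "connected_graph S" "verts S \<subseteq> verts T" "edges S \<subseteq> edges T"
    and "{u, v} \<in> edges T" "u \<in> verts S" "v \<in> verts S"
  shows "{u, v} \<in> edges S"
proof (rule ccontr)
  assume no: "{u, v} \<notin> edges S"
  have "u \<noteq> v" using assms(1,5) by (auto simp: is_tree_def simple_graph_def)
  obtain p where p: "graph_path S p" "hd p = u" "last p = v"
    using assms(2,6,7) by (auto simp: connected_graph_def linked_def)
  have "graph_path T p"
    using graph_path_mono[OF p(1) assms(3,4)] .
  moreover have "3 \<le> length p"
  proof (rule ccontr)
    assume "\<not> ?thesis"
    then have "length p = 0 \<or> length p = Suc 0 \<or> length p = Suc (Suc 0)" by linarith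
    then consider "p = []" | a where "p = [a]" | a b where "p = [a, b]"
      by (auto simp: length_Suc_conv)
    then show False
      by cases (use p no \<open>u \<noteq> v\<close> in \<open>auto simp: graph_path_def\<close>)
  qed
  ultimately have "graph_cycle T p"
    using p assms(5) by (auto simp: graph_cycle_def insert_commute)
  then show False using assms(1) by (auto simp: is_tree_def)
qed

lemma tree_card:
  assumes "is_tree T"
  shows "card (edges T) + 1 = card (verts T)"
proof -
  have V: "finite (verts T)" "verts T \<noteq> {}" "conn_on (edges T) (verts T)"
    and simple: "simple_graph T"
    using assms by (auto simp: is_tree_def connected_graph_iff simple_graph_def)
  obtain F where F: "F \<subseteq> edges T" "conn_on F (verts T)" "card F + 1 = card (verts T)"
    using exists_spanning_tree[OF V] .
  have "e \<in> F" if "e \<in> edges T" for e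
  proof -
    have "card e = 2" "e \<subseteq> verts T" using that simple by (auto simp: simple_graph_def)
    then obtain u v where "e = {u, v}" "u \<in> verts T" "v \<in> verts T"
      by (auto simp: card_2_iff)
    then show ?thesis
      using tree_subgraph_edge[OF assms, of "(verts T, F)"] that F V
      by (auto simp: connected_graph_iff)
  qed
  then show ?thesis using F by (metis subsetI subset_antisym)
qed

lemma tree_eqI:
  assumes "is_tree T" "is_tree U" "verts T = verts U" "edges T \<subseteq> edges U"
  shows "T = U"
proof -
  have "card (edges T) = card (edges U)"
    using tree_card[OF assms(1)] tree_card[OF assms(2)] assms(3) by simp
  then have "edges T = edges U"
    using assms(2,4) finite_edges card_subset_eq by (metis is_tree_def)
  then show ?thesis using assms(3) by (simp add: prod_eq_iff)
qed


section \<open>A local characterisation of junction trees\<close>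

text \<open>The case \<open>W = {}\<close> makes the whole graph connected, and the edge count then
  excludes cycles. The antichain condition stands for the maximality of cliques, and the last
  condition fixes the vertex set of the graph.\<close>

definition jtree :: "'a set \<Rightarrow> 'a set ugraph \<Rightarrow> bool" where
  "jtree Y T \<longleftrightarrow> finite Y \<and> simple_graph T \<and> verts T \<noteq> {} \<and> card (edges T) < card (verts T)
     \<and> (\<forall>W. conn_on (edges T) {c \<in> verts T. W \<subseteq> c})
     \<and> (\<forall>c\<in>verts T. \<forall>c'\<in>verts T. c \<subseteq> c' \<longrightarrow> c = c')
     \<and> \<Union>(verts T) = Y"

lemma jtreeD:
  assumes "jtree Y T"
  shows "finite Y" "simple_graph T" "verts T \<noteq> {}" "card (edges T) < card (verts T)"
    and "conn_on (edges T) {c \<in> verts T. W \<subseteq> c}" "conn_on (edges T) (verts T)"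
    and "c \<in> verts T \<Longrightarrow> c' \<in> verts T \<Longrightarrow> c \<subseteq> c' \<Longrightarrow> c = c'"
    and "\<Union>(verts T) = Y" "finite (verts T)" "finite (edges T)" "is_tree T"
proof -
  show *: "finite Y" "simple_graph T" "verts T \<noteq> {}" "card (edges T) < card (verts T)"
    "conn_on (edges T) {c \<in> verts T. W \<subseteq> c}" "\<Union>(verts T) = Y"
    "c \<in> verts T \<Longrightarrow> c' \<in> verts T \<Longrightarrow> c \<subseteq> c' \<Longrightarrow> c = c'" for W c c'
    using assms by (auto simp: jtree_def)
  show **: "conn_on (edges T) (verts T)"
    using *(5)[of "{}"] by simp
  show "finite (verts T)" "finite (edges T)"
    using *(2) by (auto simp: simple_graph_def intro: finite_edges)
  show "is_tree T"
    using is_treeI[OF *(2,3) ** *(4)] .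
qed

lemma jtree_edgeD:
  assumes "jtree Y T" "{u, v} \<in> edges T"
  shows "u \<in> verts T" "v \<in> verts T" "u \<noteq> v"
  using jtreeD(2)[OF assms(1)] assms(2) by (auto simp: simple_graph_def)

text \<open>If some node \<open>c\<close> of a path did not contain \<open>hd p \<inter> last p\<close>, then the edge entering \<open>c\<close>
  could be bypassed through the nodes containing that intersection.\<close>

lemma jtree_path:
  assumes "jtree Y T" "graph_path T p" "c \<in> set p"
  shows "hd p \<inter> last p \<subseteq> c"
proof (rule ccontr)
  assume nsub: "\<not> ?thesis"
  let ?W = "hd p \<inter> last p"
  have V: "set p \<subseteq> verts T" and dist: "distinct p"
    and succ: "successively (\<lambda>u v. {u, v} \<in> edges T) p"
    using assms(2) by (auto simp: graph_path_def)
  obtain ys zs where p: "p = ys @ c # zs"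
    using assms(3) by (auto dest: split_list)
  have "ys \<noteq> []" "zs \<noteq> []"
    using nsub p by auto
  define u where "u = last ys"
  let ?E = "edges T - {{u, c}}"
  have ys: "hd ys \<in> set ys" "u \<in> set ys" and zs: "last zs \<in> set zs"
    using \<open>ys \<noteq> []\<close> \<open>zs \<noteq> []\<close> by (auto simp: u_def)
  have e: "{u, c} \<in> edges T" and succ_ys: "successively (\<lambda>u v. {u, v} \<in> edges T) ys"
    and succ_zs: "successively (\<lambda>u v. {u, v} \<in> edges T) (c # zs)"
    using succ \<open>ys \<noteq> []\<close> unfolding p successively_append_iff by (auto simp: u_def)
  have "(hd ys, u) \<in> (walk_rel (edges T) (set ys))\<^sup>*"
    using graph_path_walk[OF \<open>ys \<noteq> []\<close> succ_ys] by (simp add: u_def)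
  then have 1: "(u, hd ys) \<in> (walk_rel ?E (verts T))\<^sup>*"
    by (rule walk_rel_rtrancl_mono[OF walk_rel_rtrancl_sym])
      (use V dist p in \<open>auto simp: doubleton_eq_iff\<close>)
  have "(c, last zs) \<in> (walk_rel (edges T) (set (c # zs)))\<^sup>*"
    using graph_path_walk[OF _ succ_zs] \<open>zs \<noteq> []\<close> by simp
  then have 2: "(last zs, c) \<in> (walk_rel ?E (verts T))\<^sup>*"
    by (rule walk_rel_rtrancl_mono[OF walk_rel_rtrancl_sym])
      (use V dist p ys in \<open>auto simp: doubleton_eq_iff\<close>)
  have "(hd ys, last zs) \<in> (walk_rel (edges T) {d \<in> verts T. ?W \<subseteq> d})\<^sup>*"
  proof -
    have "hd ys \<in> {d \<in> verts T. ?W \<subseteq> d}" "last zs \<in> {d \<in> verts T. ?W \<subseteq> d}"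
      using V p ys(1) zs \<open>ys \<noteq> []\<close> \<open>zs \<noteq> []\<close> by auto
    then show ?thesis
      using jtreeD(5)[OF assms(1), of ?W] unfolding conn_on_def by blast
  qed
  then have 3: "(hd ys, last zs) \<in> (walk_rel ?E (verts T))\<^sup>*"
    by (rule walk_rel_rtrancl_mono) (use nsub in \<open>auto simp: doubleton_eq_iff\<close>)
  have "(u, c) \<in> (walk_rel ?E (verts T))\<^sup>*"
    using rtrancl_trans[OF rtrancl_trans[OF 1 3] 2] .
  moreover have "(u, c) \<notin> (walk_rel ?E (verts T))\<^sup>*"
    using jtreeD[OF assms(1)] e V p ys by (intro edge_is_bridge) auto
  ultimately show False by simp
qed

text \<open>The first node of a path into the subtree of the nodes containing \<open>w\<close> separates \<open>c\<close> from
  that subtree.\<close>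

lemma gate_exists:
  assumes "connected_graph T"
    and jt: "\<And>p d. graph_path T p \<Longrightarrow> d \<in> set p \<Longrightarrow> hd p \<inter> last p \<subseteq> d"
    and "c \<in> verts T" "b0 \<in> verts T" "w \<in> b0"
  shows "\<exists>b\<in>verts T. w \<in> b \<and> (\<forall>b'\<in>verts T. w \<in> b' \<longrightarrow> c \<inter> b' \<subseteq> b)"
proof -
  obtain p0 where p0: "graph_path T p0" "hd p0 = c" "last p0 = b0"
    using connected_graph_pathE[OF assms(1,3,4)] .
  have "\<exists>b\<in>set p0. w \<in> b"
    using p0 assms(5) by (intro bexI[of _ b0]) (auto simp: graph_path_def)
  then obtain p b zs where p: "p0 = p @ b # zs" "w \<in> b" "\<forall>d\<in>set p. w \<notin> d"
    using split_list_first_prop by metis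
  have bV: "b \<in> verts T"
    using p p0 by (auto simp: graph_path_def)
  have "c \<inter> b' \<subseteq> b" if b': "b' \<in> verts T" "w \<in> b'" for b'
  proof -
    obtain r where r: "graph_path T r" "hd r = b" "last r = b'"
      using connected_graph_pathE[OF assms(1) bV b'(1)] .
    have "w \<in> d" if "d \<in> set r" for d
      using jt[OF r(1) that] r p(2) b' by auto
    then have "set p \<inter> set r = {}" using p(3) by auto
    moreover have "successively (\<lambda>u v. {u, v} \<in> edges T) (p @ b # zs)"
      "set p \<subseteq> verts T" "distinct p"
      using p0 p by (auto simp: graph_path_def)
    ultimately have "graph_path T (p @ r)"
      using r unfolding graph_path_def successively_append_iff by auto
    moreover have "b \<in> set (p @ r)" "hd (p @ r) = c" "last (p @ r) = b'"
      using r p0(2) p(1) by (auto simp: graph_path_def hd_append split: if_splits)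
    ultimately show ?thesis using jt by blast
  qed
  then show ?thesis using bV p(2) by blast
qed

text \<open>A node \<open>c\<close> meeting \<open>W\<close> in as many points as possible contains
  \<open>W\<close>. For a missing \<open>w\<close>, the gate from \<open>c\<close> to the nodes
  containing \<open>w\<close> would contain \<open>w\<close> and all of \<open>W \<inter> c\<close>,
  because each point of \<open>W \<inter> c\<close> shares a node with \<open>w\<close>.\<close>

lemma helly:
  assumes "connected_graph T" "finite (verts T)" "finite W"
    and jt: "\<And>p d. graph_path T p \<Longrightarrow> d \<in> set p \<Longrightarrow> hd p \<inter> last p \<subseteq> d"
    and pair: "\<And>u v. u \<in> W \<Longrightarrow> v \<in> W \<Longrightarrow> \<exists>c\<in>verts T. u \<in> c \<and> v \<in> c"
  shows "\<exists>c\<in>verts T. W \<subseteq> c"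
proof -
  have V: "verts T \<noteq> {}"
    using assms(1) by (simp add: connected_graph_def)
  let ?C = "(\<lambda>c. card (W \<inter> c)) ` verts T"
  have "Max ?C \<in> ?C"
    using V assms(2) by (intro Max_in) auto
  then obtain c where c: "c \<in> verts T" "card (W \<inter> c) = Max ?C" by auto
  have max: "card (W \<inter> c') \<le> card (W \<inter> c)" if "c' \<in> verts T" for c'
    unfolding c(2) using that assms(2) by (intro Max_ge) auto
  have "w \<in> c" if w: "w \<in> W" for w
  proof (rule ccontr)
    assume "w \<notin> c"
    obtain b0 where "b0 \<in> verts T" "w \<in> b0" using pair[OF w w] by auto
    from gate_exists[OF assms(1) jt c(1) this] obtain b where
      b: "b \<in> verts T" "w \<in> b" "\<And>b'. b' \<in> verts T \<Longrightarrow> w \<in> b' \<Longrightarrow> c \<inter> b' \<subseteq> b"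
      by blast
    have "insert w (W \<inter> c) \<subseteq> W \<inter> b"
    proof
      fix u assume "u \<in> insert w (W \<inter> c)"
      then consider "u = w" | "u \<in> W" "u \<in> c" by auto
      then show "u \<in> W \<inter> b"
        using pair[OF w, of u] b(2,3) w by cases blast+
    qed
    then have "card (insert w (W \<inter> c)) \<le> card (W \<inter> b)"
      using assms(3) by (intro card_mono) auto
    then show False
      using max[OF b(1)] \<open>w \<notin> c\<close> assms(3) by simp
  qed
  then show ?thesis using c(1) by auto
qed

section \<open>Cliques of a graph against nodes of a tree\<close>

lemma exists_clique_superset:
  assumes "finite (verts G)" "complete_in G W"
  shows "\<exists>c\<in>cliques G. W \<subseteq> c"
proof -
  let ?A = "{W'. complete_in G W' \<and> W \<subseteq> W'}"
  have "finite ?A"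
    by (rule finite_subset[of _ "Pow (verts G)"]) (use assms(1) in \<open>auto simp: complete_in_def\<close>)
  from finite_has_maximal[OF this] obtain c where c: "c \<in> ?A" "\<forall>b\<in>?A. c \<subseteq> b \<longrightarrow> c = b"
    using assms(2) by auto
  then have "c \<in> cliques G" by (auto simp: cliques_def)
  then show ?thesis using c by blast
qed

lemma junction_tree_imp_jtree:
  assumes "simple_graph G" "junction_tree_of G T"
  shows "jtree (verts G) T"
proof -
  have T: "is_tree T" "verts T = cliques G"
    and jt: "graph_path T p \<Longrightarrow> d \<in> set p \<Longrightarrow> hd p \<inter> last p \<subseteq> d" for p d
    using assms(2) by (auto simp: junction_tree_of_def)
  have fin: "finite (verts G)"
    using assms(1) by (simp add: simple_graph_def)
  have conn: "conn_on (edges T) {c \<in> verts T. W \<subseteq> c}" for W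
    unfolding conn_on_def
  proof (intro ballI)
    fix a b assume ab: "a \<in> {c \<in> verts T. W \<subseteq> c}" "b \<in> {c \<in> verts T. W \<subseteq> c}"
    then obtain p where p: "graph_path T p" "hd p = a" "last p = b"
      using connected_graph_pathE[of T a b] T(1) by (auto simp: is_tree_def)
    then have "(a, b) \<in> (walk_rel (edges T) (set p))\<^sup>*"
      using graph_path_walk[of p] by (auto simp: graph_path_def)
    moreover have "set p \<subseteq> {c \<in> verts T. W \<subseteq> c}"
      using jt[OF p(1)] p ab by (fastforce simp: graph_path_def)
    ultimately show "(a, b) \<in> (walk_rel (edges T) {c \<in> verts T. W \<subseteq> c})\<^sup>*"
      by (rule walk_rel_rtrancl_mono)
  qed
  have "v \<in> \<Union>(cliques G)" if "v \<in> verts G" for v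
    using exists_clique_superset[OF fin, of "{v}"] that by (auto simp: complete_in_def)
  moreover have "\<Union>(cliques G) \<subseteq> verts G"
    by (auto simp: cliques_def complete_in_def)
  ultimately have "\<Union>(verts T) = verts G" using T(2) by auto
  then show ?thesis
    using T tree_card[OF T(1)] fin conn
    by (auto simp: jtree_def is_tree_def connected_graph_def cliques_def)
qed

text \<open>The only candidate for a finite graph with cliques \<open>C\<close>: every edge extends
  to a clique, so two distinct vertices are adjacent iff they share a member of
  \<open>C\<close>.\<close>

definition clique_graph :: "'a set set \<Rightarrow> 'a ugraph" where
  "clique_graph C = (\<Union>C, {{u, v} | u v. u \<noteq> v \<and> (\<exists>c\<in>C. u \<in> c \<and> v \<in> c)})"

lemma jtree_imp_junction_tree:
  assumes "jtree Y T"
  shows "simple_graph (clique_graph (verts T))" "junction_tree_of (clique_graph (verts T)) T"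
proof -
  let ?G = "clique_graph (verts T)"
  note T = jtreeD[OF assms]
  show "simple_graph ?G"
    using T(1,8) by (auto simp: simple_graph_def clique_graph_def)
  have conn: "connected_graph T" using T(11) by (simp add: is_tree_def)
  have edge: "{u, v} \<in> edges ?G \<longleftrightarrow> u \<noteq> v \<and> (\<exists>c\<in>verts T. u \<in> c \<and> v \<in> c)" for u v
    by (auto simp: clique_graph_def doubleton_eq_iff)
  \<comment> \<open>Pairwise common nodes become one common node by the Helly property. The
    antichain condition then makes every node a maximal complete set.\<close>
  have complete: "complete_in ?G W \<longleftrightarrow> (\<exists>c\<in>verts T. W \<subseteq> c)" for W
  proof
    assume W: "complete_in ?G W"
    then have sub: "W \<subseteq> \<Union>(verts T)" by (simp add: complete_in_def clique_graph_def)
    then have "finite W" using T(1,8) finite_subset by auto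
    moreover have "\<exists>c\<in>verts T. u \<in> c \<and> v \<in> c" if "u \<in> W" "v \<in> W" for u v
      using W sub that by (cases "u = v") (auto simp: complete_in_def edge)
    ultimately show "\<exists>c\<in>verts T. W \<subseteq> c"
      using helly[OF conn T(9)] jtree_path[OF assms] by blast
  next
    assume "\<exists>c\<in>verts T. W \<subseteq> c"
    then show "complete_in ?G W"
      unfolding complete_in_def edge by (auto simp: clique_graph_def)
  qed
  have "cliques ?G = verts T"
  proof (intro set_eqI iffI)
    fix c assume c: "c \<in> cliques ?G"
    then obtain c' where c': "c' \<in> verts T" "c \<subseteq> c'"
      by (auto simp: cliques_def complete)
    then have "c' = c" using c unfolding cliques_def complete by blast
    then show "c \<in> verts T" using c' by simp
  next
    fix c assume c: "c \<in> verts T"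
    have "W' = c" if "c' \<in> verts T" "W' \<subseteq> c'" "c \<subseteq> W'" for c' W'
      using T(7)[OF c that(1)] that by blast
    then show "c \<in> cliques ?G"
      using c by (auto simp: cliques_def complete)
  qed
  then show "junction_tree_of ?G T"
    using T(11) jtree_path[OF assms] by (auto simp: junction_tree_of_def)
qed

lemma junction_trees_iff: "T \<in> junction_trees Y \<longleftrightarrow> jtree Y T"
proof
  assume "T \<in> junction_trees Y"
  then obtain G where "simple_graph G" "verts G = Y" "junction_tree_of G T"
    by (auto simp: junction_trees_def decomposable_def)
  then show "jtree Y T"
    using junction_tree_imp_jtree by blast
next
  assume T: "jtree Y T"
  moreover have "verts (clique_graph (verts T)) = Y"
    using jtreeD(8)[OF T] by (simp add: clique_graph_def)
  ultimately show "T \<in> junction_trees Y"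
    using jtree_imp_junction_tree[OF T] unfolding junction_trees_def decomposable_def by blast
qed

text \<open>The recursion sums over this set, and a sum over an infinite set would be 0 by
  convention.\<close>

lemma finite_junction_trees:
  assumes "finite Y"
  shows "finite (junction_trees Y)"
proof (rule finite_subset)
  show "junction_trees Y \<subseteq> Pow (Pow Y) \<times> Pow (Pow (Pow Y))"
  proof
    fix T assume "T \<in> junction_trees Y"
    then have "simple_graph T" "\<Union>(verts T) = Y"
      by (simp_all add: junction_trees_iff jtreeD)
    then have "verts T \<subseteq> Pow Y" "edges T \<subseteq> Pow (verts T)"
      by (auto simp: simple_graph_def)
    then have "verts T \<in> Pow (Pow Y)" "edges T \<in> Pow (Pow (Pow Y))"
      by blast+
    then show "T \<in> Pow (Pow Y) \<times> Pow (Pow (Pow Y))"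
      by (metis mem_Times_iff)
  qed
qed (use assms in auto)


section \<open>The expander preserves junction trees\<close>

text \<open>One run of the expander on a nonempty subtree with all random choices fixed.
  \<open>d_nsub\<close> replaces the case distinction in the choice of \<open>q\<close>, so the
  locale applies to drawn choices and to reconstructed ones alike.\<close>

locale expansion =
  fixes x :: 'a and Y :: "'a set" and T S :: "'a set ugraph"
    and d :: "'a set \<Rightarrow> 'a set" and n :: "'a set \<Rightarrow> 'a set set"
  assumes T: "jtree Y T" and x: "x \<notin> Y"
    and S: "simple_graph S" "connected_graph S" "verts S \<subseteq> verts T" "edges S \<subseteq> edges T"
    and sep_sub: "\<And>c. c \<in> verts S \<Longrightarrow> sep_union S c \<subseteq> d c"
    and d_sub: "\<And>c. c \<in> verts S \<Longrightarrow> d c \<subseteq> c"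
    and d_nsub: "\<And>c c'. c \<in> verts S \<Longrightarrow> c' \<in> neighbors S c \<Longrightarrow> \<not> d c \<subseteq> c'"
    and n_sub: "\<And>c. c \<in> verts S \<Longrightarrow> d c \<noteq> c \<Longrightarrow> n c \<subseteq> movable T S d c"
begin

abbreviation U where "U \<equiv> assemble x T S d n"

definition dx where "dx c = insert x (d c)"

definition moved where "moved c = (if d c = c then neighbors T c - verts S else n c)"

definition moved_edges where
  "moved_edges = {{c, c'} | c c'. c \<in> verts S \<and> c' \<in> moved c}"

lemma verts_U: "verts U = (verts T - {c \<in> verts S. d c = c}) \<union> dx ` verts S"
  by (auto simp: assemble_def Let_def dx_def)

lemma edges_U: "edges U = (edges T - edges S - moved_edges)
    \<union> {{dx c, dx c'} | c c'. {c, c'} \<in> edges S}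
    \<union> {{c, dx c} | c. c \<in> verts S \<and> d c \<noteq> c}
    \<union> {{dx c, c'} | c c'. c \<in> verts S \<and> c' \<in> moved c}"
  unfolding assemble_def Let_def dx_def moved_edges_def moved_def by simp

section \<open>Links and new nodes of the output\<close>

lemma edge_U_old: "e \<in> edges T \<Longrightarrow> e \<notin> edges S \<Longrightarrow> e \<notin> moved_edges \<Longrightarrow> e \<in> edges U"
  unfolding edges_U by simp

lemma edge_U_sub: "{c, c'} \<in> edges S \<Longrightarrow> {dx c, dx c'} \<in> edges U"
  unfolding edges_U by (rule UnI1, rule UnI1, rule UnI2) fast

lemma edge_U_new: "c \<in> verts S \<Longrightarrow> d c \<noteq> c \<Longrightarrow> {c, dx c} \<in> edges U"
  unfolding edges_U by (rule UnI1, rule UnI2) fast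

lemma edge_U_moved: "c \<in> verts S \<Longrightarrow> c' \<in> moved c \<Longrightarrow> {dx c, c'} \<in> edges U"
  unfolding edges_U by (rule UnI2) fast

lemma edge_U_cases:
  assumes "e \<in> edges U"
  obtains (old) "e \<in> edges T" "e \<notin> edges S" "e \<notin> moved_edges"
    | (sub) c c' where "e = {dx c, dx c'}" "{c, c'} \<in> edges S"
    | (new) c where "e = {c, dx c}" "c \<in> verts S" "d c \<noteq> c"
    | (mov) c c' where "e = {dx c, c'}" "c \<in> verts S" "c' \<in> moved c"
  using assms unfolding edges_U
  by (elim UnE CollectE exE conjE DiffE)
    (rule that(1); assumption | rule that(2); assumption | rule that(3); assumption
      | rule that(4); assumption)+

lemma x_notin: "c \<in> verts T \<Longrightarrow> x \<notin> c"
  using jtreeD(8)[OF T] x by auto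

lemma x_notin_d: "c \<in> verts S \<Longrightarrow> x \<notin> d c"
  using x_notin S(3) d_sub by blast

lemma movedD:
  assumes "c \<in> verts S" "c' \<in> moved c"
  shows "{c, c'} \<in> edges T" "c' \<notin> verts S" "c \<inter> c' \<subseteq> d c"
  using assms n_sub[OF assms(1)]
  by (auto simp: moved_def movable_def neighbors_def split: if_splits)

lemma S_edgeD:
  assumes "{a, b} \<in> edges S"
  shows "a \<in> verts S" "b \<in> verts S" "a \<noteq> b" "a \<inter> b \<subseteq> d a" "a \<inter> b \<subseteq> d b"
proof -
  show ab: "a \<in> verts S" "b \<in> verts S" "a \<noteq> b"
    using assms S(1) by (auto simp: simple_graph_def)
  have "b \<in> neighbors S a" "a \<in> neighbors S b"
    using assms by (auto simp: neighbors_def insert_commute)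
  then show "a \<inter> b \<subseteq> d a" "a \<inter> b \<subseteq> d b"
    using sep_sub[OF ab(1)] sep_sub[OF ab(2)] by (auto simp: sep_union_def)
qed

text \<open>A subtree of a tree is an induced subgraph. Hence links of \<open>T\<close> that are
  kept have an end outside \<open>S\<close>.\<close>

lemma S_induced: "{a, b} \<in> edges T \<Longrightarrow> a \<in> verts S \<Longrightarrow> b \<in> verts S \<Longrightarrow> {a, b} \<in> edges S"
  using tree_subgraph_edge[OF jtreeD(11)[OF T] S(2-4)] .

lemma moved_edges_iff:
  assumes "a \<in> verts S" "b \<notin> verts S"
  shows "{a, b} \<in> moved_edges \<longleftrightarrow> b \<in> moved a"
  using assms movedD(2) by (auto simp: moved_edges_def doubleton_eq_iff)

lemma path_in_S:
  assumes "graph_path S p" "e \<in> set p"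
  shows "hd p \<inter> last p \<subseteq> e"
  using jtree_path[OF T graph_path_mono[OF assms(1) S(3,4)] assms(2)] .

text \<open>If \<open>d c \<subseteq> d c'\<close>, then \<open>d c\<close> would lie in the neighbour of \<open>c\<close> on the path to \<open>c'\<close>.\<close>

lemma d_antichain:
  assumes "c \<in> verts S" "c' \<in> verts S" "d c \<subseteq> d c'"
  shows "c = c'"
proof (rule ccontr)
  assume "c \<noteq> c'"
  obtain p where p: "graph_path S p" "hd p = c" "last p = c'"
    using connected_graph_pathE[OF S(2) assms(1,2)] .
  then obtain e q where q: "p = c # e # q"
    using \<open>c \<noteq> c'\<close> by (cases p; cases "tl p") (auto simp: graph_path_def)
  then have "c \<inter> c' \<subseteq> e"
    using path_in_S[OF p(1)] p by auto
  then have "d c \<subseteq> e"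
    using d_sub assms by blast
  moreover have "e \<in> neighbors S c"
    using p(1) q by (auto simp: graph_path_def neighbors_def)
  ultimately show False
    using d_nsub assms(1) by blast
qed

lemma dx_sub_iff: "c \<in> verts S \<Longrightarrow> c' \<in> verts S \<Longrightarrow> dx c \<subseteq> dx c' \<longleftrightarrow> c = c'"
  using d_antichain[of c c'] x_notin_d by (auto simp: dx_def)

lemma inj_dx: "inj_on dx (verts S)"
  by (rule inj_onI) (metis dx_sub_iff order_refl)

lemma finite_S: "finite (verts S)" "finite (edges S)"
  using S(1) finite_edges[OF S(1)] by (auto simp: simple_graph_def)

section \<open>The local conditions for the output\<close>

lemma simple_U: "simple_graph U"
  unfolding simple_graph_def
proof (intro conjI ballI)
  show "finite (verts U)"
    unfolding verts_U using jtreeD(9)[OF T] finite_S by auto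
  fix e assume "e \<in> edges U"
  then have "e \<subseteq> verts U \<and> card e = 2"
  proof (cases rule: edge_U_cases)
    case old
    then have e: "e \<subseteq> verts T" "card e = 2"
      using jtreeD(2)[OF T] by (auto simp: simple_graph_def)
    \<comment> \<open>A deleted node lies on no kept link: its links inside \<open>S\<close> are
      replaced and all others are moved.\<close>
    have "\<not> (a \<in> verts S \<and> d a = a)" if a: "a \<in> e" for a
    proof
      assume aS: "a \<in> verts S \<and> d a = a"
      obtain u v where "e = {u, v}"
        using e(2) unfolding card_2_iff by blast
      then obtain b where b: "e = {a, b}"
        using a by blast
      then have "b \<notin> verts S" using S_induced[of a b] old aS by auto
      then have "b \<in> moved a" using aS b old by (auto simp: moved_def neighbors_def)
      then show False using old b aS by (auto simp: moved_edges_def)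
    qed
    then show ?thesis using e by (auto simp: verts_U)
  next
    case (sub c c')
    note e = S_edgeD[OF sub(2)]
    have "dx c \<noteq> dx c'" using e inj_onD[OF inj_dx] by blast
    then show ?thesis using e sub by (simp add: verts_U)
  next
    case (new c)
    moreover have "c \<noteq> dx c" using x_notin[of c] new S(3) by (auto simp: dx_def)
    ultimately show ?thesis using S(3) by (auto simp: verts_U)
  next
    case (mov c c')
    have c': "c' \<in> verts T" "c' \<notin> verts S"
      using jtree_edgeD[OF T movedD(1)[OF mov(2,3)]] movedD[OF mov(2,3)] by auto
    then have "dx c \<noteq> c'" using x_notin by (auto simp: dx_def)
    then show ?thesis using c' mov by (auto simp: verts_U)
  qed
  then show "e \<subseteq> verts U" "card e = 2" by auto
qed

text \<open>Replaced and moved links are images of links of \<open>T\<close> under \<open>g\<close>,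
  so the output gains at most one link for each node in \<open>R\<close>. It gains exactly
  \<open>card R\<close> nodes: \<open>verts S\<close> is copied and \<open>verts S - R\<close> is
  deleted.\<close>

lemma card_U: "card (edges U) < card (verts U)"
proof -
  define R where "R = {c \<in> verts S. d c \<noteq> c}"
  define g where "g = (\<lambda>c. if c \<in> verts S then dx c else c)"
  let ?M = "edges S \<union> moved_edges"
  have R: "R \<subseteq> verts S" "finite R" using finite_S by (auto simp: R_def)
  have "moved_edges \<subseteq> edges T"
    using movedD(1) by (auto simp: moved_edges_def)
  then have M: "?M \<subseteq> edges T" "finite ?M"
    using S(4) jtreeD(10)[OF T] finite_subset by blast+
  have "edges U \<subseteq> (edges T - ?M) \<union> (image g) ` ?M \<union> (\<lambda>c. {c, dx c}) ` R"
  proof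
    fix e assume "e \<in> edges U"
    then show "e \<in> (edges T - ?M) \<union> (image g) ` ?M \<union> (\<lambda>c. {c, dx c}) ` R"
    proof (cases rule: edge_U_cases)
      case (sub c c')
      then have "e = g ` {c, c'}" using S_edgeD[OF sub(2)] by (auto simp: g_def)
      then show ?thesis using sub by blast
    next
      case (mov c c')
      then have "e = g ` {c, c'}" using movedD[OF mov(2,3)] by (auto simp: g_def)
      moreover have "{c, c'} \<in> ?M" using mov by (auto simp: moved_edges_def)
      ultimately show ?thesis by blast
    qed (auto simp: R_def)
  qed
  then have "card (edges U) \<le> card ((edges T - ?M) \<union> (image g) ` ?M \<union> (\<lambda>c. {c, dx c}) ` R)"
    using M(2) R(2) jtreeD(10)[OF T] by (intro card_mono) auto
  also have "\<dots> \<le> card (edges T - ?M) + card ((image g) ` ?M) + card ((\<lambda>c. {c, dx c}) ` R)"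
    by (meson add_le_mono1 card_Un_le order_trans)
  also have "\<dots> \<le> card (edges T - ?M) + card ?M + card R"
    using M(2) R(2) by (intro add_mono card_image_le) auto
  also have "\<dots> = card (edges T) + card R"
    using card_Diff_subset[OF M(2,1)] card_mono[OF jtreeD(10)[OF T] M(1)] by simp
  also have "\<dots> < card (verts T) + card R"
    using jtreeD(4)[OF T] by simp
  also have "\<dots> = card (verts T - (verts S - R)) + card (verts S)"
  proof -
    have "card (verts S - R) = card (verts S) - card R"
      using card_Diff_subset[OF R(2,1)] .
    moreover have "card (verts T - (verts S - R)) = card (verts T) - card (verts S - R)"
      using finite_S S(3) by (intro card_Diff_subset) auto
    moreover have "card R \<le> card (verts S)" "card (verts S) \<le> card (verts T)"
      using R(1) finite_S S(3) jtreeD(9)[OF T] by (auto intro: card_mono)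
    ultimately show ?thesis by simp
  qed
  also have "\<dots> = card ((verts T - (verts S - R)) \<union> dx ` verts S)"
  proof -
    have "(verts T - (verts S - R)) \<inter> dx ` verts S = {}"
      using x_notin by (auto simp: dx_def)
    then show ?thesis
      using finite_S jtreeD(9)[OF T] by (simp add: card_Un_disjoint card_image[OF inj_dx])
  qed
  also have "(verts T - (verts S - R)) \<union> dx ` verts S = verts U"
    by (auto simp: verts_U R_def)
  finally show ?thesis .
qed

lemma conn_U_new:
  assumes "x \<in> W"
  shows "conn_on (edges U) {A \<in> verts U. W \<subseteq> A}"
proof -
  let ?B = "{c \<in> verts S. W - {x} \<subseteq> c}"
  have "conn_on (edges S) ?B"
    unfolding conn_on_def
  proof (intro ballI)
    fix a b assume ab: "a \<in> ?B" "b \<in> ?B"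
    then obtain p where p: "graph_path S p" "hd p = a" "last p = b"
      using connected_graph_pathE[OF S(2), of a b] by auto
    then have "(a, b) \<in> (walk_rel (edges S) (set p))\<^sup>*"
      using graph_path_walk[of p] by (auto simp: graph_path_def)
    moreover have "set p \<subseteq> ?B"
      using path_in_S[OF p(1)] p ab by (fastforce simp: graph_path_def)
    ultimately show "(a, b) \<in> (walk_rel (edges S) ?B)\<^sup>*"
      by (rule walk_rel_rtrancl_mono)
  qed
  then show ?thesis
  proof (rule conn_on_image[where f = dx])
    fix a b assume ab: "a \<in> ?B" "b \<in> ?B" "{a, b} \<in> edges S"
    \<comment> \<open>\<open>dx\<close> need not send all of \<open>?B\<close> to nodes above
      \<open>W\<close>. Along a link of \<open>S\<close> it does, since \<open>W - {x}\<close> lies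
      in the separator and hence in \<open>d a\<close> and \<open>d b\<close>.\<close>
    note e = S_edgeD[OF ab(3)]
    show "(dx a, dx b) \<in> (walk_rel (edges U) {A \<in> verts U. W \<subseteq> A})\<^sup>*"
    proof (rule walk_rel_stepI)
      show "{dx a, dx b} \<in> edges U" using ab(3) by (rule edge_U_sub)
    qed (use e ab in \<open>auto simp: verts_U dx_def\<close>)
  next
    fix A assume "A \<in> {A \<in> verts U. W \<subseteq> A}"
    then have "A \<in> verts U" "W \<subseteq> A" by auto
    moreover have "A \<notin> verts T" using x_notin \<open>W \<subseteq> A\<close> assms by auto
    ultimately obtain c where "c \<in> verts S" "A = dx c" by (auto simp: verts_U)
    then show "\<exists>a\<in>?B. (A, dx a) \<in> (walk_rel (edges U) {A \<in> verts U. W \<subseteq> A})\<^sup>*"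
      using \<open>W \<subseteq> A\<close> d_sub by (intro bexI[of _ c]) (auto simp: dx_def)
  qed
qed

text \<open>In the output \<open>rep c\<close> stands for \<open>c\<close>: it is \<open>c\<close>
  itself, or \<open>dx c\<close> if \<open>c\<close> is deleted. A link of \<open>T\<close> that is
  not kept turns into a walk via \<open>dx\<close> nodes, and these contain \<open>W\<close> because
  the separators of moved links and of links of \<open>S\<close> lie in \<open>d\<close>.\<close>

lemma conn_U_old:
  assumes "x \<notin> W"
  shows "conn_on (edges U) {A \<in> verts U. W \<subseteq> A}"
proof -
  let ?B = "{A \<in> verts U. W \<subseteq> A}"
  define rep where "rep = (\<lambda>c. if c \<in> verts S \<and> d c = c then dx c else c)"
  have rep_in: "rep c \<in> ?B" if "c \<in> verts T" "W \<subseteq> c" for c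
    using that by (auto simp: rep_def verts_U dx_def)
  have rep_dx: "(dx c, rep c) \<in> (walk_rel (edges U) ?B)\<^sup>*" if c: "c \<in> verts S" "W \<subseteq> d c" for c
  proof (cases "d c = c")
    case False
    show ?thesis
    proof (rule walk_rel_stepI)
      show "dx c \<in> ?B" using c by (auto simp: verts_U dx_def)
      show "rep c \<in> ?B" using c d_sub S(3) by (intro rep_in) auto
      have "{c, dx c} \<in> edges U" using False c by (intro edge_U_new)
      then show "{dx c, rep c} \<in> edges U" using False by (simp add: rep_def insert_commute)
    qed
  qed (use c in \<open>simp add: rep_def\<close>)
  have half: "(rep a, rep b) \<in> (walk_rel (edges U) ?B)\<^sup>*"
    if ab: "a \<in> verts T" "W \<subseteq> a" "b \<in> verts T" "W \<subseteq> b" "{a, b} \<in> edges T" "b \<notin> verts S" for a b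
  proof (cases "a \<in> verts S \<and> b \<in> moved a")
    case True
    then have "W \<subseteq> d a" using movedD[of a b] ab by auto
    then have "(rep a, dx a) \<in> (walk_rel (edges U) ?B)\<^sup>*"
      using True by (intro walk_rel_rtrancl_sym[OF rep_dx]) auto
    moreover have "(dx a, b) \<in> (walk_rel (edges U) ?B)\<^sup>*"
    proof (rule walk_rel_stepI)
      show "dx a \<in> ?B" "b \<in> ?B" using \<open>W \<subseteq> d a\<close> True ab by (auto simp: verts_U dx_def)
      show "{dx a, b} \<in> edges U" using True by (intro edge_U_moved) auto
    qed
    moreover have "rep b = b" using ab by (simp add: rep_def)
    ultimately show ?thesis by simp
  next
    case False
    then have "{a, b} \<notin> moved_edges"
      using ab(6) moved_edges_iff[of a b] by (cases "a \<in> verts S") (auto simp: moved_edges_def doubleton_eq_iff)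
    moreover have "{a, b} \<notin> edges S" using S_edgeD ab(6) by blast
    ultimately have "{a, b} \<in> edges U" using ab(5) by (intro edge_U_old)
    \<comment> \<open>Were \<open>a\<close> deleted, all its neighbours outside \<open>S\<close>
      would be moved, \<open>b\<close> among them.\<close>
    moreover have "rep b = b" "rep a = a"
      using ab False by (auto simp: rep_def moved_def neighbors_def)
    ultimately show ?thesis
      using rep_in[OF ab(1,2)] rep_in[OF ab(3,4)] by (intro walk_rel_stepI) auto
  qed
  show ?thesis
  proof (rule conn_on_image[OF jtreeD(5)[OF T], where f = rep])
    fix a b assume "a \<in> {c \<in> verts T. W \<subseteq> c}" "b \<in> {c \<in> verts T. W \<subseteq> c}" "{a, b} \<in> edges T"
    then have ab: "a \<in> verts T" "W \<subseteq> a" "b \<in> verts T" "W \<subseteq> b" "{a, b} \<in> edges T" by auto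
    consider "b \<notin> verts S" | "a \<notin> verts S" | "a \<in> verts S" "b \<in> verts S" by auto
    then show "(rep a, rep b) \<in> (walk_rel (edges U) ?B)\<^sup>*"
    proof cases
      case 1
      then show ?thesis using half ab by blast
    next
      case 2
      have "{b, a} \<in> edges T" using ab(5) by (simp add: insert_commute)
      then show ?thesis
        using walk_rel_rtrancl_sym[OF half[OF ab(3,4,1,2) _ 2]] by simp
    next
      case 3
      have e: "{a, b} \<in> edges S" using S_induced ab 3 by simp
      have W: "W \<subseteq> d a" "W \<subseteq> d b" using S_edgeD[OF e] ab by auto
      have "(dx a, dx b) \<in> (walk_rel (edges U) ?B)\<^sup>*"
      proof (rule walk_rel_stepI)
        show "dx a \<in> ?B" "dx b \<in> ?B" using W 3 by (auto simp: verts_U dx_def)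
        show "{dx a, dx b} \<in> edges U" using e by (rule edge_U_sub)
      qed
      with walk_rel_rtrancl_sym[OF rep_dx[OF 3(1) W(1)]] rep_dx[OF 3(2) W(2)]
      show ?thesis by (meson rtrancl_trans)
    qed
  next
    fix A assume A: "A \<in> ?B"
    then consider "A \<in> verts T" "\<not> (A \<in> verts S \<and> d A = A)" | c where "c \<in> verts S" "A = dx c"
      by (auto simp: verts_U)
    then show "\<exists>a\<in>{c \<in> verts T. W \<subseteq> c}. (A, rep a) \<in> (walk_rel (edges U) ?B)\<^sup>*"
    proof cases
      case 1
      then have "rep A = A" unfolding rep_def by auto
      then show ?thesis using 1 A by (intro bexI[of _ A]) auto
    next
      case 2
      then have "W \<subseteq> d c" using A assms by (auto simp: dx_def)
      then show ?thesis
        using 2 rep_dx[of c] d_sub[of c] S(3) by (intro bexI[of _ c]) auto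
    qed
  qed
qed

lemma antichain_U:
  assumes "A \<in> verts U" "B \<in> verts U" "A \<subseteq> B"
  shows "A = B"
proof -
  note anti = jtreeD(7)[OF T]
  consider (old) "A \<in> verts T" "\<not> (A \<in> verts S \<and> d A = A)" | (new) c where "c \<in> verts S" "A = dx c"
    using assms(1) by (auto simp: verts_U)
  then show ?thesis
  proof cases
    case old
    consider "B \<in> verts T" | b where "b \<in> verts S" "B = dx b"
      using assms(2) by (auto simp: verts_U)
    then show ?thesis
    proof cases
      case 1
      then show ?thesis using anti old assms by blast
    next
      case 2
      \<comment> \<open>An old node inside \<open>dx b\<close> lies in \<open>b\<close>, so it
        equals \<open>b\<close> and \<open>d b = b\<close>; but such a node has been
        deleted.\<close>
      then have "A \<subseteq> d b" using x_notin[OF old(1)] assms(3) by (auto simp: dx_def)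
      then have "A = b" "d b = b"
        using anti[OF old(1), of b] 2 d_sub[of b] S(3) by auto
      then show ?thesis using old 2 by simp
    qed
  next
    case new
    then have "B \<notin> verts T" using assms x_notin by (auto simp: dx_def)
    then show ?thesis
      using assms new dx_sub_iff by (auto simp: verts_U)
  qed
qed

lemma Union_U: "\<Union>(verts U) = insert x Y"
proof -
  have "verts S \<noteq> {}" using S(2) by (simp add: connected_graph_def)
  then have "x \<in> \<Union>(verts U)" by (auto simp: verts_U dx_def)
  moreover have "c \<subseteq> \<Union>(verts U)" if "c \<in> verts T" for c
    using that by (cases "c \<in> verts S \<and> d c = c") (auto simp: verts_U dx_def)
  moreover have "\<Union>(verts U) \<subseteq> insert x (\<Union>(verts T))"
    using d_sub S(3) by (fastforce simp: verts_U dx_def)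
  ultimately show ?thesis using jtreeD(8)[OF T] by auto
qed

lemma jtree_U: "jtree (insert x Y) U"
proof -
  have "verts U \<noteq> {}" using card_U by auto
  then show ?thesis
    unfolding jtree_def
    using jtreeD(1)[OF T] simple_U card_U conn_U_new conn_U_old antichain_U Union_U by auto
qed

end


section \<open>Every junction tree is an expansion\<close>

locale reduction =
  fixes x :: 'a and Y :: "'a set" and U :: "'a set ugraph"
  assumes U: "jtree (insert x Y) U" and x: "x \<notin> Y"
begin

definition Vx where "Vx = {D \<in> verts U. x \<in> D}"

definition stays_maximal where "stays_maximal D \<longleftrightarrow> (\<forall>A\<in>verts U. D - {x} \<subseteq> A \<longrightarrow> A = D)"

definition f where
  "f D = (if x \<notin> D then D else if stays_maximal D then D - {x}
     else SOME C. {D, C} \<in> edges U \<and> D - {x} \<subseteq> C)"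

text \<open>The condition \<open>f a \<noteq> f b\<close> discards links that the contraction turns
  into loops. In \<open>S\<close> none arise, because \<open>f\<close> is injective on
  \<open>Vx\<close>.\<close>

definition T where
  "T = (f ` verts U, {{f a, f b} | a b. {a, b} \<in> edges U \<and> f a \<noteq> f b})"

definition S where
  "S = (f ` Vx, {{f a, f b} | a b. a \<in> Vx \<and> b \<in> Vx \<and> {a, b} \<in> edges U})"

text \<open>Inverts \<open>f\<close> on \<open>Vx\<close>, so that adding \<open>x\<close> to
  \<open>d c\<close> gives back the node of \<open>U\<close> over \<open>c\<close>. Off the image
  the value \<open>{}\<close> agrees with the default of the product distribution for
  \<open>q\<close>.\<close>

definition d where
  "d c = (if c \<in> f ` Vx then inv_into Vx f c - {x} else {})"

text \<open>Links to \<open>Vx\<close> come back as links of \<open>S\<close>, and the link to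
  \<open>c\<close> as the one between \<open>c\<close> and its new node, so neither kind belongs to
  the moved neighbours.\<close>

definition n where
  "n c = (if c \<in> f ` Vx \<and> d c \<noteq> c then neighbors U (inv_into Vx f c) - Vx - {c} else {})"

lemma Vx_iff: "D \<in> Vx \<longleftrightarrow> D \<in> verts U \<and> x \<in> D"
  by (simp add: Vx_def)

section \<open>Short paths and the contraction map\<close>

lemma path3:
  assumes "{a, b} \<in> edges U" "{b, c} \<in> edges U" "a \<noteq> c"
  shows "a \<inter> c \<subseteq> b"
proof -
  have "graph_path U [a, b, c]"
    using assms jtree_edgeD[OF U] by (auto simp: graph_path_def)
  from jtree_path[OF U this, of b] show ?thesis by simp
qed

lemma path4:
  assumes "{a, b} \<in> edges U" "{b, c} \<in> edges U" "{c, e} \<in> edges U" "distinct [a, b, c, e]"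
  shows "a \<inter> e \<subseteq> b"
proof -
  have "graph_path U [a, b, c, e]"
    using assms jtree_edgeD[OF U] by (auto simp: graph_path_def)
  from jtree_path[OF U this, of b] show ?thesis by simp
qed

lemma no_triangle:
  assumes "{a, b} \<in> edges U" "{b, c} \<in> edges U"
  shows "{a, c} \<notin> edges U"
proof
  assume ac: "{a, c} \<in> edges U"
  then have "graph_cycle U [a, b, c]"
    using assms jtree_edgeD[OF U] by (auto simp: graph_path_def graph_cycle_def insert_commute)
  then show False using jtreeD(11)[OF U] by (auto simp: is_tree_def)
qed

lemma f_old [simp]: "x \<notin> D \<Longrightarrow> f D = D"
  by (simp add: f_def)

lemma f_max:
  assumes "D \<in> Vx" "stays_maximal D"
  shows "f D = D - {x}" "f D \<notin> verts U"
proof -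
  show *: "f D = D - {x}" using assms by (simp add: f_def Vx_iff)
  show "f D \<notin> verts U"
    using * jtreeD(7)[OF U, of "f D" D] assms by (auto simp: Vx_iff)
qed

text \<open>If \<open>A\<close> is another node above \<open>D - {x}\<close>, the first node
  \<open>C\<close> after \<open>D\<close> on the path to \<open>A\<close> contains
  \<open>D \<inter> A\<close>, hence \<open>D - {x}\<close>. It misses \<open>x\<close>, for
  otherwise \<open>D \<subseteq> C\<close>.\<close>

lemma f_nonmax:
  assumes "D \<in> Vx" "\<not> stays_maximal D"
  shows "{D, f D} \<in> edges U" "D - {x} \<subseteq> f D" "f D \<in> verts U" "x \<notin> f D"
proof -
  have D: "D \<in> verts U" "x \<in> D" using assms by (auto simp: Vx_iff)
  obtain A where A: "A \<in> verts U" "D - {x} \<subseteq> A" "A \<noteq> D"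
    using assms(2) by (auto simp: stays_maximal_def)
  have "connected_graph U" using jtreeD(11)[OF U] by (simp add: is_tree_def)
  then obtain p where p: "graph_path U p" "hd p = D" "last p = A"
    using connected_graph_pathE[OF _ D(1) A(1)] by blast
  then obtain C q where q: "p = D # C # q"
    using \<open>A \<noteq> D\<close> by (cases p; cases "tl p") (auto simp: graph_path_def)
  then have "D \<inter> A \<subseteq> C" using jtree_path[OF U p(1), of C] p by auto
  then have "{D, C} \<in> edges U \<and> D - {x} \<subseteq> C"
    using p(1) q A(2) by (auto simp: graph_path_def)
  then have "{D, f D} \<in> edges U \<and> D - {x} \<subseteq> f D"
    using D assms(2) unfolding f_def by simp (rule someI)
  then show *: "{D, f D} \<in> edges U" "D - {x} \<subseteq> f D" by auto
  show "f D \<in> verts U" using jtree_edgeD[OF U *(1)] by simp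
  then have "x \<in> f D \<Longrightarrow> D = f D"
    using jtreeD(7)[OF U D(1), of "f D"] *(2) by blast
  then show "x \<notin> f D" using jtree_edgeD[OF U *(1)] by blast
qed

lemma x_notin_f: "A \<in> verts U \<Longrightarrow> x \<notin> f A"
  using f_max(1) f_nonmax(4) f_old by (cases "x \<in> A"; cases "stays_maximal A") (auto simp: Vx_iff)

lemma sub_f: "A \<in> verts U \<Longrightarrow> A - {x} \<subseteq> f A"
  using f_max(1) f_nonmax(2) f_old by (cases "x \<in> A"; cases "stays_maximal A") (auto simp: Vx_iff)

text \<open>Otherwise the path \<open>D\<close>, \<open>C\<close>, \<open>D'\<close> would force
  \<open>x\<close> into \<open>C\<close>.\<close>

lemma one_neighbor_in_Vx:
  assumes "D \<in> Vx" "D' \<in> Vx" "{D, C} \<in> edges U" "{D', C} \<in> edges U" "x \<notin> C"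
  shows "D = D'"
  using path3[of D C D'] assms by (auto simp: Vx_iff insert_commute)

lemma inj_f: "inj_on f Vx"
proof (rule inj_onI)
  fix D D' assume D: "D \<in> Vx" "D' \<in> Vx" and eq: "f D = f D'"
  consider "stays_maximal D" "stays_maximal D'" | "\<not> stays_maximal D" "\<not> stays_maximal D'"
    | "stays_maximal D" "\<not> stays_maximal D'" | "\<not> stays_maximal D" "stays_maximal D'"
    by blast
  then show "D = D'"
  proof cases
    case 1
    then show ?thesis using eq D f_max(1) by (auto simp: Vx_iff)
  next
    case 2
    then show ?thesis using one_neighbor_in_Vx[OF D, of "f D"] f_nonmax D eq by metis
  \<comment> \<open>In the mixed cases one value is a node of \<open>U\<close> and the other is
    not.\<close>
  qed (use f_max(2) f_nonmax(3) D eq in metis)+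
qed

text \<open>A contracted \<open>f D\<close> is a neighbour of \<open>D\<close> on the side away from
  \<open>D'\<close>, so the path from it through \<open>D\<close> to \<open>D'\<close>, and on to
  \<open>f D'\<close> if that is contracted too, puts the intersection into
  \<open>D\<close>.\<close>

lemma sep_f_sub:
  assumes D: "D \<in> Vx" "D' \<in> Vx" and e: "{D, D'} \<in> edges U"
  shows "f D \<inter> f D' \<subseteq> D"
proof (cases "stays_maximal D")
  case True
  then show ?thesis using f_max(1) D by auto
next
  case False
  note fD = f_nonmax[OF D(1) False]
  have e': "{f D, D} \<in> edges U" using fD(1) by (simp add: insert_commute)
  have neq: "f D \<noteq> D" "f D \<noteq> D'" "D \<noteq> D'"
    using fD(4) D jtree_edgeD[OF U e] by (auto simp: Vx_iff)
  show ?thesis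
  proof (cases "stays_maximal D'")
    case True
    then show ?thesis using path3[OF e' e] neq f_max(1)[OF D(2)] by auto
  next
    case False
    note fD' = f_nonmax[OF D(2) False]
    have "distinct [f D, D, D', f D']"
      using neq fD'(4) D inj_onD[OF inj_f _ D] by (auto simp: Vx_iff)
    then show ?thesis using path4[OF e' e fD'(1)] by simp
  qed
qed

lemma sep_f:
  assumes D: "D \<in> Vx" "D' \<in> Vx" and e: "{D, D'} \<in> edges U"
  shows "f D \<inter> f D' = D \<inter> D' - {x}"
proof -
  have "{D', D} \<in> edges U" using e by (simp add: insert_commute)
  from sep_f_sub[OF D(2,1) this] sep_f_sub[OF D e]
  have "f D \<inter> f D' \<subseteq> D \<inter> D'" by blast
  then show ?thesis
    using D sub_f[of D] sub_f[of D'] x_notin_f[of D] by (auto simp: Vx_iff)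
qed

lemma verts_T_cases:
  assumes "c \<in> verts T"
  obtains (old) "c \<in> verts U" "x \<notin> c" | (max) D where "D \<in> Vx" "stays_maximal D" "c = D - {x}"
proof -
  obtain A where A: "A \<in> verts U" "c = f A" using assms by (auto simp: T_def)
  consider "x \<notin> A" | "A \<in> Vx" "stays_maximal A" | "A \<in> Vx" "\<not> stays_maximal A" using A(1) by (auto simp: Vx_iff)
  then show thesis
  proof cases
    case 1
    then show thesis using old A by simp
  next
    case 2
    then show thesis using max[of A] f_max(1) A by simp
  next
    case 3
    then show thesis using old f_nonmax(3,4) A by simp
  qed
qed

lemma edge_TI: "{a, b} \<in> edges U \<Longrightarrow> f a \<noteq> f b \<Longrightarrow> {f a, f b} \<in> edges T"
  unfolding T_def snd_conv by (rule CollectI, rule exI[of _ a], rule exI[of _ b]) simp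

lemma edge_TE:
  assumes "e \<in> edges T"
  obtains a b where "e = f ` {a, b}" "{a, b} \<in> edges U" "f a \<noteq> f b"
proof -
  obtain a b where "e = {f a, f b}" "{a, b} \<in> edges U" "f a \<noteq> f b"
    using assms unfolding T_def snd_conv by (elim CollectE exE conjE)
  then show thesis using that[of a b] by simp
qed

lemma edge_SE:
  assumes "e \<in> edges S"
  obtains a b where "e = {f a, f b}" "a \<in> Vx" "b \<in> Vx" "{a, b} \<in> edges U"
  using assms unfolding S_def snd_conv by (elim CollectE exE conjE)

lemma edge_SI:
  assumes "a \<in> Vx" "b \<in> Vx" "{a, b} \<in> edges U"
  shows "{f a, f b} \<in> edges S"
  unfolding S_def snd_conv
  by (rule CollectI, rule exI[of _ a], rule exI[of _ b]) (simp add: assms)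

lemma finite_U: "finite (verts U)" "finite (edges U)" "finite Vx"
  using jtreeD(9,10)[OF U] by (auto simp: Vx_def)

section \<open>The reduced tree\<close>

lemma finite_T: "finite (verts T)" "finite (edges T)"
proof -
  show "finite (verts T)" using finite_U by (simp add: T_def)
  have "edges T \<subseteq> (image f) ` edges U"
    by (blast elim: edge_TE)
  then show "finite (edges T)" using finite_U finite_subset by blast
qed

lemma simple_T: "simple_graph T"
  unfolding simple_graph_def
proof (intro conjI ballI)
  fix e assume "e \<in> edges T"
  then obtain a b where "e = f ` {a, b}" "{a, b} \<in> edges U" "f a \<noteq> f b"
    by (rule edge_TE)
  then show "e \<subseteq> verts T" "card e = 2"
    using jtree_edgeD[OF U] by (auto simp: T_def)
qed (use finite_T in auto)

text \<open>\<open>K\<close> consists of the contracted links. Each has exactly one end containing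
  \<open>x\<close>, so there are \<open>card R\<close> of them and all are lost. At most
  \<open>card R\<close> nodes are lost: \<open>f\<close> fixes the nodes without \<open>x\<close>
  and maps \<open>Vx - R\<close> injectively to sets that are not nodes of \<open>U\<close>.\<close>

lemma card_T: "card (edges T) < card (verts T)"
proof -
  define R where "R = {D \<in> Vx. \<not> stays_maximal D}"
  define K where "K = (\<lambda>D. {D, f D}) ` R"
  have R: "R \<subseteq> Vx" "finite R" using finite_U by (auto simp: R_def)
  have RD: "D \<in> verts U" "x \<in> D" "x \<notin> f D" "{D, f D} \<in> edges U" if "D \<in> R" for D
    using that f_nonmax by (auto simp: R_def Vx_iff)
  have "inj_on (\<lambda>D. {D, f D}) R"
    by (rule inj_onI) (metis RD(2,3) doubleton_eq_iff)
  then have cardK: "card K = card R" by (simp add: K_def card_image)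
  have K: "K \<subseteq> edges U" "finite K" using RD R(2) by (auto simp: K_def)
  have "edges T \<subseteq> (image f) ` (edges U - K)"
  proof
    fix e assume "e \<in> edges T"
    then obtain a b where ab: "e = f ` {a, b}" "{a, b} \<in> edges U" "f a \<noteq> f b"
      by (rule edge_TE)
    have "{a, b} \<notin> K"
      using ab(3) RD(3) by (auto simp: K_def doubleton_eq_iff)
    then show "e \<in> (image f) ` (edges U - K)" using ab by blast
  qed
  then have "card (edges T) \<le> card (edges U - K)"
    using finite_U by (meson card_image_le card_mono finite_Diff finite_imageI order_trans)
  also have "\<dots> = card (edges U) - card R"
    using card_Diff_subset[OF K(2,1)] cardK by simp
  also have "\<dots> < card (verts U) - card R"
    using jtreeD(4)[OF U] card_mono[OF finite_U(2) K(1)] cardK by simp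
  also have "\<dots> = card (verts U - Vx) + card (Vx - R)"
  proof -
    have "card (Vx - R) = card Vx - card R" using card_Diff_subset[OF R(2,1)] .
    moreover have "card (verts U - Vx) = card (verts U) - card Vx"
      by (rule card_Diff_subset[OF finite_U(3)]) (auto simp: Vx_iff)
    moreover have "card R \<le> card Vx" "card Vx \<le> card (verts U)"
      using R(1) finite_U by (auto intro!: card_mono simp: Vx_iff)
    ultimately show ?thesis by simp
  qed
  also have "\<dots> = card ((verts U - Vx) \<union> f ` (Vx - R))"
  proof -
    have "(verts U - Vx) \<inter> f ` (Vx - R) = {}"
      using f_max(2) by (auto simp: R_def)
    moreover have "inj_on f (Vx - R)" using inj_f by (rule inj_on_subset) auto
    ultimately show ?thesis using finite_U by (simp add: card_Un_disjoint card_image)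
  qed
  also have "\<dots> \<le> card (verts T)"
  proof (rule card_mono[OF finite_T(1)])
    have "c \<in> f ` verts U" if "c \<in> verts U - Vx" for c
      using that by (intro image_eqI[of _ _ c]) (auto simp: Vx_iff)
    then show "(verts U - Vx) \<union> f ` (Vx - R) \<subseteq> verts T"
      by (auto simp: T_def Vx_iff)
  qed
  finally show ?thesis .
qed

lemma conn_T: "conn_on (edges T) {c \<in> verts T. W \<subseteq> c}"
proof (cases "x \<in> W")
  case True
  then have "{c \<in> verts T. W \<subseteq> c} = {}" using x_notin_f by (auto simp: T_def)
  then show ?thesis by (metis conn_on_def empty_iff)
next
  case False
  let ?B = "{c \<in> verts T. W \<subseteq> c}"
  have f_in: "f a \<in> ?B" if "a \<in> verts U" "W \<subseteq> a" for a
    using that sub_f[of a] False by (auto simp: T_def)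
  show ?thesis
  proof (rule conn_on_image[OF jtreeD(5)[OF U], where f = f])
    fix a b assume "a \<in> {c \<in> verts U. W \<subseteq> c}" "b \<in> {c \<in> verts U. W \<subseteq> c}" "{a, b} \<in> edges U"
    then show "(f a, f b) \<in> (walk_rel (edges T) ?B)\<^sup>*"
      using f_in by (cases "f a = f b") (auto intro!: walk_rel_stepI edge_TI)
  next
    fix c assume c: "c \<in> ?B"
    then have "c \<in> verts T" by simp
    then show "\<exists>a\<in>{c \<in> verts U. W \<subseteq> c}. (c, f a) \<in> (walk_rel (edges T) ?B)\<^sup>*"
    proof (cases rule: verts_T_cases)
      case old
      then show ?thesis using c by (intro bexI[of _ c]) auto
    next
      case (max D)
      then show ?thesis using c f_max(1)[of D] by (intro bexI[of _ D]) (auto simp: Vx_iff)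
    qed
  qed
qed

lemma antichain_T:
  assumes "A \<in> verts T" "B \<in> verts T" "A \<subseteq> B"
  shows "A = B"
  using assms(1)
proof (cases rule: verts_T_cases)
  case old
  note A = this
  from assms(2) show ?thesis
  proof (cases rule: verts_T_cases)
    case old
    then show ?thesis using jtreeD(7)[OF U] A assms by blast
  next
    case (max D)
    then have "A = D" using jtreeD(7)[OF U A(1), of D] assms(3) by (auto simp: Vx_iff)
    then show ?thesis using A max by (simp add: Vx_iff)
  qed
next
  case (max D)
  note A = this
  from assms(2) show ?thesis
  proof (cases rule: verts_T_cases)
    case old
    then show ?thesis using A assms(3) by (auto simp: stays_maximal_def Vx_iff)
  next
    case (max D')
    then have "D' = D" using A assms(3) by (auto simp: stays_maximal_def Vx_iff)
    then show ?thesis using A max by simp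
  qed
qed

lemma Union_T: "\<Union>(verts T) = Y"
proof
  show "\<Union>(verts T) \<subseteq> Y"
  proof
    fix v assume "v \<in> \<Union>(verts T)"
    then obtain c where c: "c \<in> verts T" "v \<in> c" by blast
    have "v \<in> insert x Y"
      unfolding jtreeD(8)[OF U, symmetric] using c(1)
      by (cases rule: verts_T_cases) (use c(2) in \<open>auto simp: Vx_iff\<close>)
    moreover have "x \<notin> c" using c(1) x_notin_f by (auto simp: T_def)
    ultimately show "v \<in> Y" using c(2) by auto
  qed
  show "Y \<subseteq> \<Union>(verts T)"
  proof
    fix v assume v: "v \<in> Y"
    then have "v \<in> \<Union>(verts U)" using jtreeD(8)[OF U] by auto
    then obtain A where "A \<in> verts U" "v \<in> A" by auto
    then show "v \<in> \<Union>(verts T)" using sub_f[of A] x v by (auto simp: T_def)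
  qed
qed

lemma jtree_T: "jtree Y T"
proof -
  have "verts T \<noteq> {}" using card_T by auto
  then show ?thesis
    unfolding jtree_def
    using jtreeD(1)[OF U] simple_T card_T conn_T antichain_T Union_T by auto
qed

section \<open>The subtree and the choices that undo the reduction\<close>

lemma S_sub: "verts S \<subseteq> verts T" "edges S \<subseteq> edges T"
proof -
  show "verts S \<subseteq> verts T" by (auto simp: S_def T_def Vx_iff)
  show "edges S \<subseteq> edges T"
  proof
    fix e assume "e \<in> edges S"
    then obtain a b where ab: "e = {f a, f b}" "a \<in> Vx" "b \<in> Vx" "{a, b} \<in> edges U"
      by (rule edge_SE)
    then have "f a \<noteq> f b" using jtree_edgeD[OF U ab(4)] inj_onD[OF inj_f] by blast
    then show "e \<in> edges T" unfolding ab(1) using ab(4) by (intro edge_TI)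
  qed
qed

lemma simple_S: "simple_graph S"
proof -
  have "e \<subseteq> verts S" if "e \<in> edges S" for e
    using that by (auto elim!: edge_SE simp: S_def)
  moreover have "finite (verts S)" using finite_U by (simp add: S_def)
  ultimately show ?thesis
    using S_sub(2) simple_T by (auto simp: simple_graph_def)
qed

lemma connected_S: "connected_graph S"
proof -
  have "x \<in> \<Union>(verts U)" using jtreeD(8)[OF U] by simp
  then have "Vx \<noteq> {}" by (auto simp: Vx_iff)
  moreover have "conn_on (edges U) Vx"
    using jtreeD(5)[OF U, of "{x}"] by (simp add: Vx_def)
  then have "conn_on (edges S) (verts S)"
  proof (rule conn_on_image[where f = f])
    fix a b assume "a \<in> Vx" "b \<in> Vx" "{a, b} \<in> edges U"
    then show "(f a, f b) \<in> (walk_rel (edges S) (verts S))\<^sup>*"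
      by (intro walk_rel_stepI edge_SI) (auto simp: S_def)
  qed (auto simp: S_def)
  ultimately show ?thesis by (simp add: connected_graph_iff) (simp add: S_def)
qed

lemma d_f: "D \<in> Vx \<Longrightarrow> d (f D) = D - {x}"
  by (simp add: d_def inv_into_f_f[OF inj_f])

lemma d_f_eq_iff: "D \<in> Vx \<Longrightarrow> d (f D) = f D \<longleftrightarrow> stays_maximal D"
  using f_max(1)[of D] f_nonmax(3)[of D] jtreeD(7)[OF U, of "f D" D]
  by (auto simp: d_f Vx_iff)

lemma n_f: "D \<in> Vx \<Longrightarrow> \<not> stays_maximal D \<Longrightarrow> n (f D) = neighbors U D - Vx - {f D}"
  by (simp add: n_def d_f_eq_iff inv_into_f_f[OF inj_f])

lemma neighbors_S:
  assumes "D \<in> Vx" "c \<in> neighbors S (f D)"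
  obtains D' where "D' \<in> Vx" "{D, D'} \<in> edges U" "c = f D'"
proof -
  obtain a b where ab: "{f D, c} = {f a, f b}" "a \<in> Vx" "b \<in> Vx" "{a, b} \<in> edges U"
    using assms(2) unfolding neighbors_def mem_Collect_eq by (rule edge_SE)
  from ab(1) consider "f D = f a" "c = f b" | "f D = f b" "c = f a"
    by (auto simp: doubleton_eq_iff)
  then show thesis
  proof cases
    case 1
    then have "D = a" using inj_onD[OF inj_f] assms(1) ab(2) by metis
    then show thesis using that[of b] 1 ab by simp
  next
    case 2
    then have "D = b" using inj_onD[OF inj_f] assms(1) ab(3) by metis
    then show thesis using that[of a] 2 ab by (simp add: insert_commute)
  qed
qed

lemma sep_neighbor:
  assumes "D \<in> Vx" "c \<in> neighbors S (f D)"
  shows "f D \<inter> c \<subseteq> d (f D)"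
  by (rule neighbors_S[OF assms]) (use assms(1) sep_f[of D] in \<open>auto simp: d_f\<close>)

text \<open>Containment would give
  \<open>D - {x} \<subseteq> f D \<inter> f D' = D \<inter> D' - {x}\<close> and so
  \<open>D \<subseteq> D'\<close>, against the antichain.\<close>

lemma d_not_sub_neighbor:
  assumes "D \<in> Vx" "c \<in> neighbors S (f D)"
  shows "\<not> d (f D) \<subseteq> c"
proof
  assume sub: "d (f D) \<subseteq> c"
  obtain D' where D': "D' \<in> Vx" "{D, D'} \<in> edges U" "c = f D'"
    using neighbors_S[OF assms] .
  have "D - {x} \<subseteq> f D \<inter> f D'"
    using sub sub_f[of D] assms(1) D'(3) by (auto simp: d_f Vx_iff)
  then have "D \<subseteq> D'"
    using sep_f[OF assms(1) D'(1,2)] D'(1) by (auto simp: Vx_iff)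
  then show False
    using jtreeD(7)[OF U, of D D'] jtree_edgeD[OF U D'(2)] by blast
qed

text \<open>If \<open>C = f D'\<close>, then \<open>D'\<close> was contracted into \<open>C\<close>,
  so \<open>C\<close> is a neighbour of both \<open>D\<close> and \<open>D'\<close>; without
  \<open>x\<close> in \<open>C\<close> this leaves \<open>D' = D\<close>.\<close>

lemma neighbor_in_S:
  assumes "D \<in> Vx" "{D, C} \<in> edges U" "x \<notin> C" "C \<in> verts S"
  shows "\<not> stays_maximal D \<and> C = f D"
proof -
  obtain D' where D': "D' \<in> Vx" "C = f D'" using assms(4) by (auto simp: S_def)
  have "C \<in> verts U" using jtree_edgeD[OF U assms(2)] by simp
  then have "\<not> stays_maximal D'" using f_max(2) D' by blast
  then have "{D', C} \<in> edges U" using f_nonmax(1) D' by blast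
  then have "D = D'" using one_neighbor_in_Vx D' assms by blast
  then show ?thesis using D' \<open>\<not> stays_maximal D'\<close> by simp
qed

lemma n_movable:
  assumes D: "D \<in> Vx" "\<not> stays_maximal D" and C: "C \<in> n (f D)"
  shows "C \<in> movable T S d (f D)"
proof -
  note fD = f_nonmax[OF D]
  have C': "{D, C} \<in> edges U" "C \<notin> Vx" "C \<noteq> f D"
    using C by (auto simp: n_f[OF D] neighbors_def)
  then have "C \<in> verts U" "x \<notin> C" using jtree_edgeD[OF U C'(1)] by (auto simp: Vx_iff)
  have "{f D, f C} \<in> edges T" 
    using C' \<open>x \<notin> C\<close> by (intro edge_TI) auto
  moreover have "C \<notin> verts S" using neighbor_in_S[OF D(1) C'(1) \<open>x \<notin> C\<close>] C'(3) by blast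
  moreover have "C \<inter> f D \<subseteq> D"
    using path3[of C D "f D"] C' fD(1) by (simp add: insert_commute)
  ultimately show ?thesis
    using \<open>x \<notin> C\<close> D(1) fD(4) by (auto simp: movable_def neighbors_def d_f)
qed

text \<open>The forward analysis now applies. In particular the rebuilt graph is known to be a tree
  before it is compared with \<open>U\<close>.\<close>

sublocale E: expansion x Y T S d n
proof
  show "jtree Y T" "x \<notin> Y" "simple_graph S" "connected_graph S"
    "verts S \<subseteq> verts T" "edges S \<subseteq> edges T"
    using jtree_T x simple_S connected_S S_sub by auto
  fix c assume "c \<in> verts S"
  then obtain D where D: "D \<in> Vx" "c = f D" by (auto simp: S_def)
  show "sep_union S c \<subseteq> d c"
    using sep_neighbor[OF D(1)] D(2) by (auto simp: sep_union_def)
  show "d c \<subseteq> c" using D sub_f[of D] by (auto simp: d_f Vx_iff)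
  show "\<not> d c \<subseteq> c'" if "c' \<in> neighbors S c" for c'
    using d_not_sub_neighbor D that by simp
  show "n c \<subseteq> movable T S d c" if "d c \<noteq> c"
    using n_movable[OF D(1)] d_f_eq_iff[OF D(1)] D(2) that by blast
qed

section \<open>Recovering the given tree\<close>

lemma dx_f: "D \<in> Vx \<Longrightarrow> E.dx (f D) = D"
  by (auto simp: E.dx_def d_f Vx_iff)

lemma verts_assemble: "verts (assemble x T S d n) = verts U"
proof -
  have "E.dx ` verts S = Vx"
    using dx_f by (force simp: S_def image_iff)
  moreover have "verts T - {c \<in> verts S. d c = c} = verts U - Vx"
  proof (intro set_eqI iffI)
    fix c assume c: "c \<in> verts T - {c \<in> verts S. d c = c}"
    then have "c \<in> verts T" by simp
    then show "c \<in> verts U - Vx"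
    proof (cases rule: verts_T_cases)
      case (max D)
      then have "c = f D" using f_max by simp
      then show ?thesis using c d_f_eq_iff[OF max(1)] max by (auto simp: S_def)
    qed (simp add: Vx_iff)
  next
    fix c assume c: "c \<in> verts U - Vx"
    then have "c \<in> verts T" by (auto simp: T_def Vx_iff intro!: image_eqI[of _ _ c])
    moreover have "\<not> stays_maximal D" if "D \<in> Vx" "c = f D" for D
      using that f_max(2) c by blast
    ultimately show "c \<in> verts T - {c \<in> verts S. d c = c}"
      using d_f_eq_iff by (auto simp: S_def)
  qed
  ultimately show ?thesis by (auto simp: E.verts_U Vx_iff)
qed

text \<open>Three origins of such a link: the contracted link \<open>{A, f A}\<close> returns as the
  link from \<open>f A\<close> to its new node \<open>A\<close>, a maximal \<open>A\<close> takes
  over all outside neighbours of \<open>f A\<close>, and otherwise \<open>B\<close> was put into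
  \<open>n (f A)\<close>.\<close>

lemma edge_assemble_boundary:
  assumes A: "A \<in> Vx" and B: "x \<notin> B" and e: "{A, B} \<in> edges U"
  shows "{A, B} \<in> edges (assemble x T S d n)"
proof -
  have fA: "f A \<in> verts S" using A by (simp add: S_def)
  have BU: "B \<in> verts U" using jtree_edgeD[OF U e] by simp
  show ?thesis
  proof (cases "\<not> stays_maximal A \<and> B = f A")
    case True
    then show ?thesis
      using E.edge_U_new[OF fA] d_f_eq_iff[OF A] dx_f[OF A] by (simp add: insert_commute)
  next
    case False
    have "B \<in> E.moved (f A)"
    proof (cases "stays_maximal A")
      case True
      have "f A \<noteq> B" using f_max(2)[OF A True] BU by blast
      then have "{f A, f B} \<in> edges T"
        using e B by (intro edge_TI) simp_all
      moreover have "B \<notin> verts S" using neighbor_in_S[OF A e B] True by blast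
      ultimately show ?thesis
        using True d_f_eq_iff[OF A] B by (simp add: E.moved_def neighbors_def)
    next
      case nmax: False
      then show ?thesis
        using False d_f_eq_iff[OF A] B e
        by (simp add: E.moved_def n_f[OF A nmax] neighbors_def Vx_iff)
    qed
    then show ?thesis using E.edge_U_moved[OF fA] dx_f[OF A] by simp
  qed
qed

lemma edge_assemble_old:
  assumes AB: "x \<notin> A" "x \<notin> B" and e: "{A, B} \<in> edges U"
  shows "{A, B} \<in> edges (assemble x T S d n)"
proof (rule E.edge_U_old)
  have V: "A \<in> verts U" "B \<in> verts U" "A \<noteq> B" using jtree_edgeD[OF U e] by auto
  have nonmax: "\<not> stays_maximal D" if "D \<in> Vx" "f D \<in> {A, B}" for D
    using f_max(2)[OF that(1)] that(2) V by auto
  have "{f A, f B} \<in> edges T" using e V(3) AB by (intro edge_TI) simp_all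
  then show "{A, B} \<in> edges T" using AB by simp
  \<comment> \<open>Otherwise \<open>D\<close>, \<open>f D\<close>, \<open>f D'\<close>,
    \<open>D'\<close> would be a path whose ends contain \<open>x\<close> and whose inner nodes do
    not.\<close>
  show "{A, B} \<notin> edges S"
  proof
    assume "{A, B} \<in> edges S"
    then obtain D D' where D: "{A, B} = {f D, f D'}" "D \<in> Vx" "D' \<in> Vx" "{D, D'} \<in> edges U"
      by (rule edge_SE)
    have "f D \<in> {A, B}" "f D' \<in> {A, B}" using D(1) by auto
    then have "{D, f D} \<in> edges U" "{f D', D'} \<in> edges U" "x \<notin> f D" "x \<notin> f D'"
      using f_nonmax nonmax D(2,3) by (auto simp: insert_commute)
    moreover have "{f D, f D'} \<in> edges U" using D(1) e by simp
    moreover have "D \<noteq> D'" "f D \<noteq> f D'"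
      using jtree_edgeD[OF U D(4)] jtree_edgeD[OF U \<open>{f D, f D'} \<in> edges U\<close>] by auto
    ultimately have "D \<inter> D' \<subseteq> f D"
      using D(2,3) by (intro path4[of D "f D" "f D'" D']) (auto simp: Vx_iff)
    then show False using D(2,3) \<open>x \<notin> f D\<close> by (auto simp: Vx_iff)
  qed
  \<comment> \<open>A moved link would close a triangle of \<open>D\<close>, \<open>c\<close> and
    \<open>C\<close> in \<open>U\<close>.\<close>
  show "{A, B} \<notin> E.moved_edges"
  proof
    assume "{A, B} \<in> E.moved_edges"
    then obtain c C where c: "{A, B} = {c, C}" "c \<in> verts S" "C \<in> E.moved c"
      by (auto simp: E.moved_edges_def)
    then obtain D where D: "D \<in> Vx" "c = f D" by (auto simp: S_def)
    have nmax: "\<not> stays_maximal D" using nonmax D c(1) by auto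
    then have "{D, C} \<in> edges U"
      using c(3) D d_f_eq_iff[OF D(1)] by (simp add: E.moved_def n_f neighbors_def)
    moreover have "{D, c} \<in> edges U" using f_nonmax[OF D(1) nmax] D(2) by simp
    moreover have "{c, C} \<in> edges U" using e c(1) by simp
    ultimately show False using no_triangle[of D c C] by blast
  qed
qed

lemma assemble_eq: "assemble x T S d n = U"
proof -
  have "e \<in> edges (assemble x T S d n)" if e: "e \<in> edges U" for e
  proof -
    have "card e = 2" using e jtreeD(2)[OF U] by (auto simp: simple_graph_def)
    then obtain A B where AB: "e = {A, B}" by (auto simp: card_2_iff)
    have V: "A \<in> verts U" "B \<in> verts U" using jtree_edgeD[OF U] e AB by auto
    consider "A \<in> Vx" "B \<in> Vx" | "A \<in> Vx" "x \<notin> B" | "x \<notin> A" "B \<in> Vx" | "x \<notin> A" "x \<notin> B"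
      using V by (auto simp: Vx_iff)
    then show ?thesis
    proof cases
      case 1
      then have "{f A, f B} \<in> edges S" using e AB by (intro edge_SI) simp_all
      then show ?thesis using E.edge_U_sub[of "f A" "f B"] 1 AB dx_f by simp
    next
      case 2
      then show ?thesis using edge_assemble_boundary[of A B] e AB by simp
    next
      case 3
      then show ?thesis using edge_assemble_boundary[of B A] e AB by (simp add: insert_commute)
    next
      case 4
      then show ?thesis using edge_assemble_old e AB by simp
    qed
  qed
  then have "U = assemble x T S d n"
    using tree_eqI[OF jtreeD(11)[OF U] jtreeD(11)[OF E.jtree_U]] verts_assemble by blast
  then show ?thesis ..
qed

end


section \<open>Positivity of the kernels\<close>

lemma extra_choices_sub: "q \<in> extra_choices S c \<Longrightarrow> q \<subseteq> c - sep_union S c"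
  by (auto simp: extra_choices_def split: if_splits)

lemma finite_extra_choices: "finite c \<Longrightarrow> finite (extra_choices S c)"
  by (auto simp: extra_choices_def)

text \<open>\<open>pmf_of_set\<close> is uniform only on finite nonempty sets. Where the empty
  choice is excluded, the full difference remains, and it is nonempty because \<open>c\<close> is
  not inside its neighbour.\<close>

lemma extra_choices_nonempty:
  assumes "\<And>c'. c' \<in> neighbors S c \<Longrightarrow> \<not> c \<subseteq> c'"
  shows "extra_choices S c \<noteq> {}"
proof (cases "\<exists>c'\<in>neighbors S c. sep_union S c = c \<inter> c'")
  case True
  then have "c - sep_union S c \<noteq> {}" using assms by auto
  then have "c - sep_union S c \<in> extra_choices S c"
    using True by (auto simp: extra_choices_def)
  then show ?thesis by blast
qed (auto simp: extra_choices_def)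

lemma subtreesD:
  assumes "S \<in> subtrees T" "S \<noteq> ({}, {})"
  shows "simple_graph S" "connected_graph S" "verts S \<subseteq> verts T" "edges S \<subseteq> edges T"
  using assms by (auto simp: subtrees_def)

text \<open>From here on only admissible choices matter, not their probabilities.
  \<open>PiE_dflt\<close> fixes the value \<open>{}\<close> off the index set.\<close>

lemma set_pmf_expand_nonempty:
  assumes T: "jtree Y T" and S: "simple_graph S" "verts S \<subseteq> verts T" "edges S \<subseteq> edges T"
  shows "U \<in> set_pmf (expand_nonempty x T S) \<longleftrightarrow>
    (\<exists>q n. q \<in> PiE_dflt (verts S) {} (extra_choices S)
      \<and> n \<in> PiE_dflt {c \<in> verts S. sep_union S c \<union> q c \<noteq> c} {}
              (\<lambda>c. Pow (movable T S (\<lambda>c. sep_union S c \<union> q c) c))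
      \<and> U = assemble x T S (\<lambda>c. sep_union S c \<union> q c) n)"
proof -
  have fin: "finite (verts S)" using S(1) by (simp add: simple_graph_def)
  have set_q: "set_pmf (pmf_of_set (extra_choices S c)) = extra_choices S c" if c: "c \<in> verts S" for c
  proof (rule set_pmf_of_set)
    have "c \<subseteq> Y" using jtreeD(8)[OF T] S(2) c by auto
    then show "finite (extra_choices S c)"
      using jtreeD(1)[OF T] finite_extra_choices finite_subset by metis
    show "extra_choices S c \<noteq> {}"
    proof (rule extra_choices_nonempty)
      fix c' assume "c' \<in> neighbors S c"
      then have e: "{c, c'} \<in> edges T" using S(3) by (auto simp: neighbors_def)
      show "\<not> c \<subseteq> c'"
        using jtree_edgeD[OF T e] jtreeD(7)[OF T, of c c'] by blast
    qed
  qed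
  have set_n: "set_pmf (pmf_of_set (Pow (movable T S d c))) = Pow (movable T S d c)" for d c
  proof (rule set_pmf_of_set)
    have "movable T S d c \<subseteq> verts T"
      using jtree_edgeD[OF T] by (auto simp: movable_def neighbors_def)
    then show "finite (Pow (movable T S d c))"
      using jtreeD(9)[OF T] finite_subset by blast
  qed auto
  have *: "set_pmf (Pi_pmf (verts S) {} (\<lambda>c. pmf_of_set (extra_choices S c)))
      = PiE_dflt (verts S) {} (extra_choices S)"
    unfolding set_Pi_pmf[OF fin] PiE_dflt_def using set_q by simp
  have **: "set_pmf (Pi_pmf {c \<in> verts S. d c \<noteq> c} {} (\<lambda>c. pmf_of_set (Pow (movable T S d c))))
      = PiE_dflt {c \<in> verts S. d c \<noteq> c} {} (\<lambda>c. Pow (movable T S d c))" for d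
    using fin by (subst set_Pi_pmf) (simp_all add: set_n o_def)
  show ?thesis
    unfolding expand_nonempty_def Let_def by (auto simp: * **)
qed

lemma jtree_expand_nonempty:
  assumes T: "jtree Y T" and x: "x \<notin> Y"
    and S: "simple_graph S" "connected_graph S" "verts S \<subseteq> verts T" "edges S \<subseteq> edges T"
    and U: "U \<in> set_pmf (expand_nonempty x T S)"
  shows "jtree (insert x Y) U"
proof -
  obtain q n where q: "q \<in> PiE_dflt (verts S) {} (extra_choices S)"
    and n: "n \<in> PiE_dflt {c \<in> verts S. sep_union S c \<union> q c \<noteq> c} {}
              (\<lambda>c. Pow (movable T S (\<lambda>c. sep_union S c \<union> q c) c))"
    and U: "U = assemble x T S (\<lambda>c. sep_union S c \<union> q c) n"
    using U unfolding set_pmf_expand_nonempty[OF T S(1,3,4)] by blast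
  have qc: "q c \<in> extra_choices S c" if "c \<in> verts S" for c
    using q that by (auto simp: PiE_dflt_def)
  interpret expansion x Y T S "\<lambda>c. sep_union S c \<union> q c" n
  proof
    fix c assume c: "c \<in> verts S"
    show "sep_union S c \<union> q c \<subseteq> c"
      using extra_choices_sub[OF qc[OF c]] by (auto simp: sep_union_def)
    show "n c \<subseteq> movable T S (\<lambda>c. sep_union S c \<union> q c) c" if "sep_union S c \<union> q c \<noteq> c"
      using n that c by (auto simp: PiE_dflt_def)
    fix c' assume c': "c' \<in> neighbors S c"
    show "\<not> sep_union S c \<union> q c \<subseteq> c'"
    proof
      assume sub: "sep_union S c \<union> q c \<subseteq> c'"
      \<comment> \<open>This is the case in which \<open>q c\<close> had to be nonempty, yet
        \<open>q c\<close> lies in \<open>c \<inter> c'\<close> and avoids the separators, so it is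
        empty.\<close>
      have "sep_union S c = c \<inter> c'"
        using sub c' by (auto simp: sep_union_def)
      then show False
        using sub c' qc[OF c] by (auto simp: extra_choices_def split: if_splits)
    qed
  qed (use T x S in auto)
  show ?thesis using jtree_U U by simp
qed

lemma finite_graphs_on:
  assumes "finite V"
  shows "finite {U. simple_graph U \<and> verts U = V}"
proof (rule finite_subset)
  show "{U. simple_graph U \<and> verts U = V} \<subseteq> {V} \<times> Pow (Pow V)"
    by (auto simp: simple_graph_def)
qed (use assms in auto)

text \<open>Links with nonempty separator are kept, so for \<open>W \<noteq> {}\<close> without
  \<open>x\<close> the nodes above \<open>W\<close> stay connected through old links, however the
  forest is joined. Only \<open>{x}\<close> contains \<open>x\<close>, and \<open>W = {}\<close>
  asks just for connectedness of the output.\<close>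

lemma jtree_expand_empty:
  assumes T: "jtree Y T" and x: "x \<notin> Y" and Y: "Y \<noteq> {}"
    and U: "U \<in> set_pmf (expand_empty x T)"
  shows "jtree (insert x Y) U"
proof -
  note T' = jtreeD[OF T]
  define c0 where "c0 = (SOME c. c \<in> verts T)"
  define V where "V = insert {x} (verts T)"
  define E where "E = insert {{x}, c0} (edges T)"
  define F where "F = {e \<in> E. \<Inter>e \<noteq> {}}"
  let ?Us = "{U. is_tree U \<and> verts U = V \<and> F \<subseteq> edges U}"
  have c0: "c0 \<in> verts T" unfolding c0_def using T'(3) by (simp add: some_in_eq)
  have xT: "x \<notin> c" if "c \<in> verts T" for c using T'(8) x that by auto
  then have xV: "{x} \<notin> verts T" by blast
  \<comment> \<open>An empty node lies below every node, so it would be the only one and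
    \<open>Y\<close> would be empty.\<close>
  have ne: "c \<noteq> {}" if "c \<in> verts T" for c
    using T'(7)[of c] T'(8) Y that by auto
  have "is_tree (V, E)"
  proof (rule is_treeI)
    show "simple_graph (V, E)"
      using T'(2) c0 xV by (auto simp: simple_graph_def V_def E_def card_insert_if)
    have "(a, c0) \<in> (walk_rel E V)\<^sup>*" if "a \<in> V" for a
    proof (cases "a = {x}")
      case True
      then show ?thesis using c0 by (intro walk_rel_stepI) (auto simp: V_def E_def)
    next
      case False
      then have "(a, c0) \<in> (walk_rel (edges T) (verts T))\<^sup>*"
        using that T'(6) c0 by (auto simp: conn_on_def V_def)
      then show ?thesis by (rule walk_rel_rtrancl_mono) (auto simp: V_def E_def)
    qed
    then show "conn_on (edges (V, E)) (verts (V, E))" by (auto intro: conn_onI_center)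
    have "{{x}, c0} \<notin> edges T" using jtree_edgeD[OF T] xV by blast
    then show "card (edges (V, E)) < card (verts (V, E))"
      using T'(4,9,10) xV by (simp add: V_def E_def)
  qed (simp add: V_def)
  \<comment> \<open>The tree before the deletion of links is itself a candidate, so the uniform
    choice is from a nonempty set.\<close>
  then have "(V, E) \<in> ?Us" by (auto simp: F_def)
  then have "?Us \<noteq> {}" by blast
  moreover have "finite ?Us"
    by (rule finite_subset[OF _ finite_graphs_on[of V]]) (use T'(9) in \<open>auto simp: is_tree_def V_def\<close>)
  ultimately have "set_pmf (pmf_of_set ?Us) = ?Us"
    by (rule set_pmf_of_set)
  moreover have "expand_empty x T = pmf_of_set ?Us"
    unfolding expand_empty_def Let_def F_def E_def V_def c0_def ..
  ultimately have "U \<in> ?Us"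
    using U by simp
  then have tree: "is_tree U" and verts: "verts U = V" and F: "F \<subseteq> edges U" by auto
  have conn: "conn_on (edges U) {A \<in> verts U. W \<subseteq> A}" for W
  proof -
    consider "x \<in> W" | "W = {}" | "x \<notin> W" "W \<noteq> {}" by blast
    then show ?thesis
    proof cases
      case 1
      then have "{A \<in> verts U. W \<subseteq> A} \<subseteq> {{x}}"
        using xT by (auto simp: verts V_def)
      then show ?thesis unfolding conn_on_def by blast
    next
      case 2
      then show ?thesis using tree by (simp add: is_tree_def connected_graph_iff)
    next
      case 3
      then have eq: "{A \<in> verts U. W \<subseteq> A} = {A \<in> verts T. W \<subseteq> A}"
        by (auto simp: verts V_def)
      show ?thesis
        unfolding eq conn_on_def
      proof (intro ballI)
        fix a b assume "a \<in> {A \<in> verts T. W \<subseteq> A}" "b \<in> {A \<in> verts T. W \<subseteq> A}"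
        then have "(a, b) \<in> (walk_rel (edges T) {A \<in> verts T. W \<subseteq> A})\<^sup>*"
          using T'(5)[of W] unfolding conn_on_def by blast
        then show "(a, b) \<in> (walk_rel (edges U) {A \<in> verts T. W \<subseteq> A})\<^sup>*"
        proof (rule walk_rel_rtrancl_mono)
          fix u v assume "u \<in> {A \<in> verts T. W \<subseteq> A}" "v \<in> {A \<in> verts T. W \<subseteq> A}" "{u, v} \<in> edges T"
          then have "{u, v} \<in> F" using 3 by (auto simp: F_def E_def)
          then show "{u, v} \<in> edges U" using F by blast
        qed simp
      qed
    qed
  qed
  have anti: "A = B" if "A \<in> V" "B \<in> V" "A \<subseteq> B" for A B
    using that T'(7)[of A B] xT[of B] ne[of A] xT[of A] by (auto simp: V_def)
  have "\<Union>V = insert x Y" using T'(8) by (simp add: V_def)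
  then show ?thesis
    unfolding jtree_def
    using T'(1) tree tree_card[OF tree] conn anti
    by (auto simp: is_tree_def verts V_def)
qed

lemma jtree_expand:
  assumes "jtree Y T" "x \<notin> Y" "Y \<noteq> {}" "S \<in> subtrees T" "U \<in> set_pmf (expand x T S)"
  shows "jtree (insert x Y) U"
proof (cases "S = ({}, {})")
  case True
  then show ?thesis using jtree_expand_empty[OF assms(1-3)] assms(5) by (simp add: expand_def)
next
  case False
  then show ?thesis
    using jtree_expand_nonempty[OF assms(1,2) subtreesD[OF assms(4) False]] assms(5)
    by (simp add: expand_def)
qed

lemma expand_surj:
  assumes "jtree (insert x Y) U" "x \<notin> Y"
  shows "\<exists>T S. jtree Y T \<and> S \<in> subtrees T \<and> U \<in> set_pmf (expand x T S)"
proof -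
  interpret reduction x Y U using assms by unfold_locales
  define q where "q c = d c - sep_union S c" for c
  \<comment> \<open>Off the subtree all choices take the default \<open>{}\<close>, so
    \<open>sep_union S c \<union> q c\<close> agrees with \<open>d c\<close> for every
    \<open>c\<close>, as equality of functions demands.\<close>
  have out: "sep_union S c = {}" "d c = {}" "n c = {}" if "c \<notin> verts S" for c
    using that simple_S by (auto simp: sep_union_def neighbors_def simple_graph_def d_def n_def S_def)
  have dq: "sep_union S c \<union> q c = d c" for c
    using E.sep_sub[of c] out[of c] by (cases "c \<in> verts S") (auto simp: q_def)
  have "q \<in> PiE_dflt (verts S) {} (extra_choices S)"
  proof -
    have "q c \<in> extra_choices S c" if c: "c \<in> verts S" for c
    proof -
      have "q c \<noteq> {}" if "c' \<in> neighbors S c" "sep_union S c = c \<inter> c'" for c'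
        using E.d_nsub[OF c that(1)] that(2) by (auto simp: q_def)
      then show ?thesis
        using E.d_sub[OF c] by (auto simp: extra_choices_def q_def)
    qed
    then show ?thesis using out by (auto simp: PiE_dflt_def q_def)
  qed
  moreover have "n \<in> PiE_dflt {c \<in> verts S. d c \<noteq> c} {} (\<lambda>c. Pow (movable T S d c))"
    using E.n_sub out(3) by (auto simp: PiE_dflt_def n_def S_def)
  ultimately have "U \<in> set_pmf (expand_nonempty x T S)"
    unfolding set_pmf_expand_nonempty[OF jtree_T simple_S S_sub]
    using assemble_eq dq by (intro exI[of _ q] exI[of _ n]) simp
  moreover have "S \<noteq> ({}, {})" using connected_S by (auto simp: connected_graph_def)
  moreover have "S \<in> subtrees T"
    using simple_S connected_S S_sub by (simp add: subtrees_def)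
  ultimately have "S \<in> subtrees T \<and> U \<in> set_pmf (expand x T S)"
    by (simp add: expand_def)
  then show ?thesis using jtree_T by blast
qed

section \<open>From supports to positivity\<close>

lemma finite_subtrees:
  assumes "jtree Y T"
  shows "finite (subtrees T)"
proof (rule finite_subset)
  show "subtrees T \<subseteq> Pow (verts T) \<times> Pow (edges T)"
    by (auto simp: subtrees_def)
qed (use jtreeD[OF assms] in auto)

lemma subtree_kernel_pos:
  assumes "0 < \<alpha>" "\<alpha> < 1" "0 < \<beta>" "\<beta> < 1" "jtree Y T" "S \<in> subtrees T"
  shows "subtree_kernel \<alpha> \<beta> T S > 0"
proof (cases "S = ({}, {})")
  case False
  note S = subtreesD[OF assms(6) False]
  have "card (verts S) > 0" "card (verts T) > 0"
    using S jtreeD(3,9)[OF assms(5)]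
    by (auto simp: card_gt_0_iff simple_graph_def connected_graph_def)
  then show ?thesis
    using False assms by (auto simp: subtree_kernel_def Let_def)
qed (use assms in \<open>simp add: subtree_kernel_def\<close>)

lemma sum_pos_iff:
  fixes g :: "'b \<Rightarrow> real"
  assumes "finite A" "\<And>a. a \<in> A \<Longrightarrow> 0 \<le> g a"
  shows "0 < sum g A \<longleftrightarrow> (\<exists>a\<in>A. 0 < g a)"
  using sum_nonneg[of A g] sum_nonneg_eq_0_iff[OF assms(1), of g] assms(2)
  by (auto simp: order_less_le)

lemma expander_kernel_pos_iff:
  assumes "0 < \<alpha>" "\<alpha> < 1" "0 < \<beta>" "\<beta> < 1" "jtree Y T"
  shows "expander_kernel \<alpha> \<beta> x T U > 0 \<longleftrightarrow> (\<exists>S\<in>subtrees T. U \<in> set_pmf (expand x T S))"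
    and "expander_kernel \<alpha> \<beta> x T U \<ge> 0"
proof -
  note pos = subtree_kernel_pos[OF assms]
  show "expander_kernel \<alpha> \<beta> x T U \<ge> 0"
    unfolding expander_kernel_def using pos by (intro sum_nonneg) (simp add: less_imp_le)
  have "expander_kernel \<alpha> \<beta> x T U > 0 \<longleftrightarrow>
      (\<exists>S\<in>subtrees T. 0 < subtree_kernel \<alpha> \<beta> T S * pmf (expand x T S) U)"
    unfolding expander_kernel_def using pos
    by (intro sum_pos_iff finite_subtrees[OF assms(5)]) (simp add: less_imp_le)
  also have "\<dots> \<longleftrightarrow> (\<exists>S\<in>subtrees T. U \<in> set_pmf (expand x T S))"
    using pos by (intro bex_cong refl) (auto simp: zero_less_mult_iff pmf_positive_iff)
  finally show "expander_kernel \<alpha> \<beta> x T U > 0 \<longleftrightarrow> (\<exists>S\<in>subtrees T. U \<in> set_pmf (expand x T S))" .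
qed

lemma marginal_nonneg:
  assumes "0 < \<alpha>" "\<alpha> < 1" "0 < \<beta>" "\<beta> < 1"
  shows "marginal \<alpha> \<beta> y m U \<ge> 0"
proof (induction m arbitrary: U)
  case (Suc m)
  show ?case
  proof (cases m)
    case (Suc k)
    have "0 \<le> marginal \<alpha> \<beta> y m T * expander_kernel \<alpha> \<beta> (y (Suc m)) T U"
      if "T \<in> junction_trees (y ` {1..m})" for T
      using Suc.IH expander_kernel_pos_iff(2)[OF assms, of _ T] that
      by (intro mult_nonneg_nonneg) (auto simp: junction_trees_iff)
    then show ?thesis
      using Suc by (auto intro: sum_nonneg)
  qed simp
qed simp

text \<open>Base of the induction. An empty node would lie below \<open>{v}\<close>, so the
  antichain condition excludes it.\<close>

lemma jtree_singleton: "jtree {v} U \<longleftrightarrow> U = ({{v}}, {})"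
proof
  assume U: "jtree {v} U"
  note U' = jtreeD[OF U]
  have "v \<in> \<Union>(verts U)" using U'(8) by simp
  moreover have "verts U \<subseteq> {{}, {v}}" using U'(8) by (auto simp: subset_singleton_iff)
  ultimately have v: "{v} \<in> verts U" by auto
  moreover have "{} \<notin> verts U" using U'(7)[OF _ v, of "{}"] by auto
  ultimately have "verts U = {{v}}" using \<open>verts U \<subseteq> {{}, {v}}\<close> by auto
  then show "U = ({{v}}, {})" using U'(4,10) by (simp add: prod_eq_iff)
next
  assume "U = ({{v}}, {})"
  then show "jtree {v} U"
    by (auto simp: jtree_def simple_graph_def conn_on_def)
qed

theorem theorem2:
  fixes \<alpha> \<beta> :: real and y :: "nat \<Rightarrow> 'v" and m :: nat
  assumes "0 < \<alpha>" "\<alpha> < 1" "0 < \<beta>" "\<beta> < 1"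
    and "m \<ge> 1"
    and "inj_on y {1..m}"
  shows "Supp (marginal \<alpha> \<beta> y m) = junction_trees (y ` {1..m})"
proof -
  note ab = assms(1-4)
  have "marginal \<alpha> \<beta> y m U > 0 \<longleftrightarrow> jtree (y ` {1..m}) U" for U
    using assms(5,6)
  proof (induction m arbitrary: U rule: nat_induct_at_least)
    case base
    then show ?case by (simp add: jtree_singleton)
  next
    case (Suc m)
    let ?Y = "y ` {1..m}" and ?x = "y (Suc m)"
    obtain k where k: "m = Suc k" using Suc.hyps by (cases m) auto
    have Y: "y ` {1..Suc m} = insert ?x ?Y"
      by (simp add: atLeastAtMostSuc_conv)
    have x: "?x \<notin> ?Y"
    proof
      assume "?x \<in> ?Y"
      then obtain i where "i \<in> {1..m}" "y (Suc m) = y i" by auto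
      then show False using inj_onD[OF Suc.prems, of "Suc m" i] by auto
    qed
    have ne: "?Y \<noteq> {}" using Suc.hyps by simp
    have inj: "inj_on y {1..m}" using Suc.prems by (rule inj_on_subset) auto
    have IH: "marginal \<alpha> \<beta> y m T > 0 \<longleftrightarrow> jtree ?Y T" for T
      using Suc.IH[OF inj] .
    have "marginal \<alpha> \<beta> y (Suc m) U
        = (\<Sum>T\<in>junction_trees ?Y. marginal \<alpha> \<beta> y m T * expander_kernel \<alpha> \<beta> ?x T U)"
      by (simp add: k)
    moreover have "0 \<le> marginal \<alpha> \<beta> y m T * expander_kernel \<alpha> \<beta> ?x T U"
      if "T \<in> junction_trees ?Y" for T
      using that unfolding junction_trees_iff
      by (intro mult_nonneg_nonneg marginal_nonneg expander_kernel_pos_iff(2) ab)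
    ultimately have "marginal \<alpha> \<beta> y (Suc m) U > 0 \<longleftrightarrow>
        (\<exists>T\<in>junction_trees ?Y. 0 < marginal \<alpha> \<beta> y m T * expander_kernel \<alpha> \<beta> ?x T U)"
      using sum_pos_iff[OF finite_junction_trees[of ?Y]] by simp
    \<comment> \<open>By the induction hypothesis every junction tree over \<open>?Y\<close> has
      positive weight, so a term is positive iff its kernel value is.\<close>
    also have "\<dots> \<longleftrightarrow> (\<exists>T. jtree ?Y T \<and> (\<exists>S\<in>subtrees T. U \<in> set_pmf (expand ?x T S)))"
    proof -
      have "0 < marginal \<alpha> \<beta> y m T * expander_kernel \<alpha> \<beta> ?x T U \<longleftrightarrow>
          (\<exists>S\<in>subtrees T. U \<in> set_pmf (expand ?x T S))" if T: "jtree ?Y T" for T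
      proof -
        have "0 < marginal \<alpha> \<beta> y m T" using IH T by blast
        then show ?thesis
          unfolding expander_kernel_pos_iff(1)[OF ab T, symmetric] by (simp add: zero_less_mult_iff)
      qed
      then show ?thesis unfolding Bex_def junction_trees_iff by blast
    qed
    also have "\<dots> \<longleftrightarrow> jtree (insert ?x ?Y) U"
      using jtree_expand[OF _ x ne] expand_surj[OF _ x] by blast
    finally show ?case unfolding Y .
  qed
  then show ?thesis by (auto simp: Supp_def junction_trees_iff)
qed

end
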